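(* Let $D\subset\mathbb{R}^d$ $(d\geq 2)$ be a convex domain and let $\xi\in\partial D$ be a $k$-strongly convex boundary point. Then there exist $c,C_1,C_2>0$ and a neighborhood $U$ of $\xi$ such that for all $x\in D\cap U$ and $v\in\mathbb{R}^d$ we have $$\max\left\{\frac{\|v_N\|}{2\delta_D(x)},\ c\frac{\|v_T\|}{\delta_D(x)^{1/2}}\right\}\leq q_D^{(k)}(x,v)\leq \left((1+C_1\delta_D(x))\frac{\|v_N\|^2}{4\delta_D(x)^2}+C_2\frac{\|v_T\|^2}{\delta_D(x)}\right)^{1/2}.$$
   Context: Here $k\in\{1,\dots,d\}$. A domain is a connected open set; $\|\cdot\|$ and $\langle\cdot,\cdot\rangle$ are the Euclidean norm and scalar product, $d_{Euc}$ is Euclidean distance, and $\delta_D(x)$ is the Euclidean distance from $x$ to $\partial D$. A $\mathcal{C}^2$-smooth local defining function at $\xi\in\partial D$ is a $\mathcal{C}^2$ function $\rho\colon W\to\mathbb{R}$ on a neighborhood $W$ of $\xi$ with $D\cap W=\{\rho<0\}$, $\partial D\cap W=\{\rho=0\}$ and $\nabla\rho\neq0$ on $\partial D\cap W$; if one exists, $\xi$ is a $\mathcal{C}^2$-smooth boundary point, with unit outer normal $n_\xi:=\nabla\rho(\xi)/\|\nabla\rho(\xi)\|$ and tangent space $T_\xi\partial D:=\{v\in\mathbb{R}^d:\langle v,n_\xi\rangle=0\}$. The point $\xi$ is a $k$-strongly convex boundary point if it is locally convex (there is a neighborhood $W'$ of $\xi$ with $D\cap W'$ convex) and there exists (equivalently,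 for all) a $\mathcal{C}^2$-smooth local defining function $\rho$ at $\xi$ such that the Hessian of $\rho$ at $\xi$ restricted to $T_\xi\partial D$ has at least $d-k$ positive eigenvalues (with multiplicity). $U$ is taken small enough that every $x\in U$ has a unique nearest point $\pi(x)\in\partial D$, which is a $\mathcal{C}^2$-smooth boundary point; then $v_N:=\langle v,n_{\pi(x)}\rangle n_{\pi(x)}$ and $v_T:=v-v_N$. For $x\in D$, $v\in\mathbb{R}^d$, $$\delta_D^{(k)}(x,v):=\sup\{d_{Euc}(x,(x+V)\cap\partial D): V\subseteq\mathbb{R}^d\text{ a $k$-dimensional linear subspace with } v\in V\},$$ where the distance to the empty set is $+\infty$, and the (generalized) $k$-quasi-hyperbolic metric is $q_D^{(k)}(x,v):=\frac{\|v\|}{2\delta_D^{(k)}(x,v)}$ (equal to $0$ if $\delta_D^{(k)}(x,v)=+\infty$).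
   Formalization: The upper bound is claimed only for k<d; for k=d it is always false, since q_D^{(d)}(x,v)=‖v‖/(2δ_D(x)) violates it for tangential v as δ_D(x)→0 (e.g. a half-space). The lower bound is kept for all 1≤k≤d. *)

theory Defs
  imports "HOL-Analysis.Analysis"
begin

definition grad :: "('a::euclidean_space \<Rightarrow> real) \<Rightarrow> 'a \<Rightarrow> 'a"
  where "grad f x = (THE g. GDERIV f x :> g)"

definition hessian :: "('a::euclidean_space \<Rightarrow> real) \<Rightarrow> 'a \<Rightarrow> 'a \<Rightarrow> 'a"
  where "hessian f x = frechet_derivative (grad f) (at x)"

text \<open>To be used for open \<open>W\<close>. In finite dimension, continuity of \<open>hessian f x h\<close> in \<open>x\<close> for every
  fixed \<open>h\<close> is the same as continuity of all second partial derivatives.\<close>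

definition C2_on :: "('a::euclidean_space \<Rightarrow> real) \<Rightarrow> 'a set \<Rightarrow> bool"
  where "C2_on f W \<longleftrightarrow>
    (\<forall>x\<in>W. f differentiable (at x)) \<and>
    (\<forall>x\<in>W. grad f differentiable (at x)) \<and>
    (\<forall>h. continuous_on W (\<lambda>x. hessian f x h))"

definition C2_defining_function ::
    "'a::euclidean_space set \<Rightarrow> 'a \<Rightarrow> 'a set \<Rightarrow> ('a \<Rightarrow> real) \<Rightarrow> bool"
  where "C2_defining_function D \<xi> W \<rho> \<longleftrightarrow>
    open W \<and> \<xi> \<in> W \<and> C2_on \<rho> W \<and>
    D \<inter> W = {x \<in> W. \<rho> x < 0} \<and>
    frontier D \<inter> W = {x \<in> W. \<rho> x = 0} \<and>
    (\<forall>x \<in> frontier D \<inter> W. grad \<rho> x \<noteq> 0)"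

definition C2_boundary_point :: "'a::euclidean_space set \<Rightarrow> 'a \<Rightarrow> bool"
  where "C2_boundary_point D \<xi> \<longleftrightarrow>
    \<xi> \<in> frontier D \<and> (\<exists>W \<rho>. C2_defining_function D \<xi> W \<rho>)"

text \<open>At a \<open>C\<^sup>2\<close>-smooth boundary point the unit vector does not depend on the choice of \<open>\<rho>\<close>;
  elsewhere the value is irrelevant.\<close>

definition outer_normal :: "'a::euclidean_space set \<Rightarrow> 'a \<Rightarrow> 'a"
  where "outer_normal D \<xi> =
    (SOME n. \<exists>W \<rho>. C2_defining_function D \<xi> W \<rho> \<and> n = grad \<rho> \<xi> /\<^sub>R norm (grad \<rho> \<xi>))"

definition tangent_space :: "'a::euclidean_space set \<Rightarrow> 'a \<Rightarrow> 'a set"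
  where "tangent_space D \<xi> = {v. v \<bullet> outer_normal D \<xi> = 0}"

definition normal_part :: "'a::euclidean_space set \<Rightarrow> 'a \<Rightarrow> 'a \<Rightarrow> 'a"
  where "normal_part D p v = (v \<bullet> outer_normal D p) *\<^sub>R outer_normal D p"

definition tangential_part :: "'a::euclidean_space set \<Rightarrow> 'a \<Rightarrow> 'a \<Rightarrow> 'a"
  where "tangential_part D p v = v - normal_part D p v"

text \<open>The Hessian form restricted to the tangent space is represented there by the self-adjoint
  operator \<open>P \<circ> hessian \<rho> \<xi>\<close>, where \<open>P = tangential_part D \<xi>\<close> is the orthogonal projection onto
  the tangent space.\<close>

definition tangential_eigenspace ::
    "'a::euclidean_space set \<Rightarrow> 'a \<Rightarrow> ('a \<Rightarrow> real) \<Rightarrow> real \<Rightarrow> 'a set"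
  where "tangential_eigenspace D \<xi> \<rho> \<mu> =
    {v \<in> tangent_space D \<xi>. tangential_part D \<xi> (hessian \<rho> \<xi> v) = \<mu> *\<^sub>R v}"

text \<open>Number of positive eigenvalues with multiplicity. The operator is self-adjoint on a
  finite-dimensional space, so the index set is finite and the geometric multiplicity is the
  multiplicity.\<close>

definition num_pos_eigenvalues :: "'a::euclidean_space set \<Rightarrow> 'a \<Rightarrow> ('a \<Rightarrow> real) \<Rightarrow> nat"
  where "num_pos_eigenvalues D \<xi> \<rho> =
    (\<Sum>\<mu> | \<mu> > 0 \<and> tangential_eigenspace D \<xi> \<rho> \<mu> \<noteq> {0}. dim (tangential_eigenspace D \<xi> \<rho> \<mu>))"

definition strongly_convex_boundary_point :: "nat \<Rightarrow> 'a::euclidean_space set \<Rightarrow> 'a \<Rightarrow> bool"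
  where "strongly_convex_boundary_point k D \<xi> \<longleftrightarrow>
    \<xi> \<in> frontier D \<and>
    (\<exists>W. open W \<and> \<xi> \<in> W \<and> convex (D \<inter> W)) \<and>
    (\<exists>W \<rho>. C2_defining_function D \<xi> W \<rho> \<and> num_pos_eigenvalues D \<xi> \<rho> \<ge> DIM('a) - k)"

definition bdist :: "'a::euclidean_space set \<Rightarrow> 'a \<Rightarrow> real"
  where "bdist D x = infdist x (frontier D)"

text \<open>In contrast to \<^const>\<open>infdist\<close>, the distance to the empty set is \<open>\<infinity>\<close>.\<close>

definition einfdist :: "'a::metric_space \<Rightarrow> 'a set \<Rightarrow> ereal"
  where "einfdist x S = (INF y\<in>S. ereal (dist x y))"

definition k_bdist :: "nat \<Rightarrow> 'a::euclidean_space set \<Rightarrow> 'a \<Rightarrow> 'a \<Rightarrow> ereal"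
  where "k_bdist k D x v =
    (SUP V\<in>{V. subspace V \<and> dim V = k \<and> v \<in> V}. einfdist x ((+) x ` V \<inter> frontier D))"

definition k_quasi_hyperbolic :: "nat \<Rightarrow> 'a::euclidean_space set \<Rightarrow> 'a \<Rightarrow> 'a \<Rightarrow> real"
  where "k_quasi_hyperbolic k D x v =
    (if k_bdist k D x v = \<infinity> then 0 else norm v / (2 * real_of_ereal (k_bdist k D x v)))"

end

theory Submission
  imports Defs
begin

text \<open>Let \<open>\<delta>\<close> be the distance of \<open>x\<close> to the boundary, \<open>p\<close> a nearest boundary point and \<open>n\<close> the outer normal
at \<open>p\<close>. The proof compares \<open>D\<close> near \<open>p\<close> with three model sets.

The supporting half-space at \<open>p\<close> contains \<open>D\<close>. It forces \<open>p = x + \<delta> n\<close>, and the line through \<open>x\<close> in the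
direction \<open>v\<close> has to leave \<open>D\<close> within distance \<open>\<delta> * norm v / \<bar>v \<bullet> n\<bar>\<close>. Every \<open>V\<close> that contains \<open>v\<close> contains
this line, which bounds \<open>k_bdist\<close> from above and gives the normal lower estimate of the metric
(\<open>einfdist_le_along_normal\<close>).

A ball of a radius \<open>R\<close> independent of \<open>p\<close> touches the boundary at \<open>p\<close> from inside
(\<open>uniform_interior_ball\<close>). It makes the nearest point unique for \<open>x\<close> in \<open>D\<close>, while outside \<open>D\<close>
convexity does. Choosing \<open>V\<close> as \<open>v\<close> plus directions orthogonal to \<open>v\<close> and \<open>n\<close>, the slice of the ball by
\<open>x + V\<close> yields the upper estimate by an elementary computation
(\<open>interior_ball_slice_bound\<close>, \<open>k_quasi_hyperbolic_upper_bound\<close>). This computation yields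
the coefficient 1 for the normal term, which the factor \<open>1 + C1 * \<delta>\<close> with \<open>C1 = 1\<close> only enlarges.

In the directions of positive curvature, finally, \<open>D\<close> is thinner than a paraboloid. By symmetry of the Hessian the
positive eigenvalues give a tangential space of dimension at least \<open>d - k\<close> on which the Hessian
form is positive definite. Adding \<open>n\<close>, one gets a space that every \<open>k\<close>-dimensional \<open>V\<close> meets in a
nonzero vector, and along this vector \<open>x + V\<close> leaves \<open>D\<close> within a distance \<open>C * sqrt \<delta>\<close>
(\<open>einfdist_le_sqrt_bdist\<close>). This bound on \<open>k_bdist\<close> does not depend on \<open>v\<close>, and it gives even
\<open>norm v\<close> in place of the tangential part of \<open>v\<close> in the second lower estimate.\<close>

section \<open>Second-order calculus\<close>

lemma has_derivative_grad:
  assumes "f differentiable (at x)"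
  shows "(f has_derivative (\<lambda>h. h \<bullet> grad f x)) (at x)"
proof -
  obtain f' where f': "(f has_derivative f') (at x)"
    using assms by (auto simp: differentiable_def)
  interpret bounded_linear f' using f' by (rule has_derivative_bounded_linear)
  define g where "g = (\<Sum>b\<in>Basis. f' b *\<^sub>R b)"
  have "f' h = h \<bullet> g" for h
  proof -
    have "f' h = f' (\<Sum>b\<in>Basis. (h \<bullet> b) *\<^sub>R b)" by (simp add: euclidean_representation)
    also have "\<dots> = h \<bullet> g" by (simp add: sum scale g_def inner_sum_right mult.commute)
    finally show ?thesis .
  qed
  then have g: "GDERIV f x :> g"
    unfolding gderiv_def using f' by (metis (no_types, lifting) ext)
  have "g' = g" if "GDERIV f x :> g'" for g'
  proof -
    have "(\<lambda>h. h \<bullet> g') = (\<lambda>h. h \<bullet> g)"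
      using that g unfolding gderiv_def by (rule has_derivative_unique)
    then have "(g' - g) \<bullet> g' = (g' - g) \<bullet> g" by metis
    then have "(g' - g) \<bullet> (g' - g) = 0" by (simp add: inner_diff_right)
    then show ?thesis by simp
  qed
  then have "GDERIV f x :> grad f x"
    unfolding grad_def using g by (metis theI)
  then show ?thesis by (simp add: gderiv_def)
qed

lemma has_derivative_hessian:
  assumes "grad f differentiable (at x)"
  shows "(grad f has_derivative hessian f x) (at x)"
  using assms unfolding hessian_def by (simp add: frechet_derivative_works)

text \<open>This is Taylor's formula with Lagrange remainder for the restriction of \<open>f\<close> to the segment. It
is the source of every comparison of the domain with a ball or with a paraboloid below.\<close>

lemma second_order_Taylor:
  assumes f: "C2_on f W" and seg: "closed_segment x (x + w) \<subseteq> W"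
  obtains z where "z \<in> closed_segment x (x + w)"
    "f (x + w) = f x + w \<bullet> grad f x + (hessian f z w \<bullet> w) / 2"
proof -
  \<comment> \<open>The restriction to the segment and its first two derivatives; only the orders 0, 1, 2 occur.\<close>
  define diff where "diff = (\<lambda>m t. if m = 0 then f (x + t *\<^sub>R w)
     else if m = (1::nat) then w \<bullet> grad f (x + t *\<^sub>R w)
     else hessian f (x + t *\<^sub>R w) w \<bullet> w)"
  have inW: "x + t *\<^sub>R w \<in> closed_segment x (x + w)" if "0 \<le> t" "t \<le> 1" for t
    using that unfolding closed_segment_def by (auto intro!: exI[of _ t] simp: algebra_simps)
  have d0: "((\<lambda>t. f (x + t *\<^sub>R w)) has_real_derivative w \<bullet> grad f (x + t *\<^sub>R w)) (at t)"
    if "0 \<le> t" "t \<le> 1" for t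
  proof -
    have "f differentiable (at (x + t *\<^sub>R w))"
      using f seg inW[OF that] by (auto simp: C2_on_def)
    note D = has_derivative_grad[OF this]
    have "((\<lambda>t. f (x + t *\<^sub>R w)) has_derivative (\<lambda>h. (h *\<^sub>R w) \<bullet> grad f (x + t *\<^sub>R w))) (at t)"
      by (rule has_derivative_compose[of "\<lambda>t. x + t *\<^sub>R w" "\<lambda>h. h *\<^sub>R w", OF _ D]) (auto intro!: derivative_eq_intros)
    then show ?thesis
      unfolding has_field_derivative_def by (rule has_derivative_eq_rhs) auto
  qed
  have d1: "((\<lambda>t. w \<bullet> grad f (x + t *\<^sub>R w)) has_real_derivative hessian f (x + t *\<^sub>R w) w \<bullet> w) (at t)"
    if "0 \<le> t" "t \<le> 1" for t
  proof -
    have "grad f differentiable (at (x + t *\<^sub>R w))"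
      using f seg inW[OF that] by (auto simp: C2_on_def)
    note H = has_derivative_hessian[OF this]
    have "((\<lambda>t. grad f (x + t *\<^sub>R w)) has_derivative (\<lambda>h. hessian f (x + t *\<^sub>R w) (h *\<^sub>R w))) (at t)"
      by (rule has_derivative_compose[of "\<lambda>t. x + t *\<^sub>R w" "\<lambda>h. h *\<^sub>R w", OF _ H]) (auto intro!: derivative_eq_intros)
    from has_derivative_inner_right[OF this, of w]
    show ?thesis
      unfolding has_field_derivative_def
      by (rule has_derivative_eq_rhs)
        (auto simp: linear_simps(5)[OF has_derivative_bounded_linear[OF H]] inner_commute)
  qed
  have "\<exists>t. 0 < t \<and> t \<le> (1::real) \<and> diff 0 1 = (\<Sum>m<2. diff m 0 / (fact m) * 1 ^ m) + diff 2 t / fact 2 * 1 ^ 2"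
    by (rule Maclaurin2) (use d0 d1 in \<open>auto simp: diff_def less_2_cases_iff\<close>)
  then obtain t where t: "0 < t" "t \<le> 1"
    "diff 0 1 = (\<Sum>m<2. diff m 0 / (fact m) * 1 ^ m) + diff 2 t / fact 2 * 1 ^ 2" by blast
  show thesis
    by (rule that[OF inW[of t]]) (use t in \<open>auto simp: diff_def numeral_2_eq_2\<close>)
qed

text \<open>Write the second difference as the increment over \<open>[0, t]\<close> of
\<open>\<phi> s = f (x + s u + t v) - f (x + s u)\<close>. By the mean value theorem it is \<open>t\<close> times a difference of
two gradients along \<open>u\<close>, and differentiability of the gradient at the single point \<open>x\<close> evaluates
this difference up to \<open>o(t)\<close>. The second difference is symmetric in \<open>u\<close> and \<open>v\<close>, hence so is its
leading coefficient.\<close>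

lemma mixed_difference_approx:
  assumes r: "r > 0" and f: "\<And>y. y \<in> ball x r \<Longrightarrow> f differentiable (at y)"
    and g: "grad f differentiable (at x)" and e: "e > 0"
  shows "\<exists>d>0. \<forall>t. 0 < t \<and> t < d \<longrightarrow>
    \<bar>f (x + t *\<^sub>R u + t *\<^sub>R v) - f (x + t *\<^sub>R u) - f (x + t *\<^sub>R v) + f x
       - t\<^sup>2 * (hessian f x v \<bullet> u)\<bar> \<le> e * t\<^sup>2"
proof -
  note H = has_derivative_hessian[OF g]
  interpret H: bounded_linear "hessian f x" using H by (rule has_derivative_bounded_linear)
  \<comment> \<open>\<open>L\<close> is the factor by which the linearization error of the gradient at the two evaluation points is
  amplified; the summand 1 keeps it positive when \<open>u\<close> vanishes.\<close>
  define L where "L = (2 * norm u + norm v) * norm u + 1"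
  have L: "L > 0" unfolding L_def by (auto intro!: add_nonneg_pos)
  obtain d1 where d1: "d1 > 0" "\<And>y. norm (y - x) < d1 \<Longrightarrow>
      norm (grad f y - grad f x - hessian f x (y - x)) \<le> e / L * norm (y - x)"
    using H e L unfolding has_derivative_at_alt by (meson divide_pos_pos)
  define M where "M = norm u + norm v + 1"
  have M: "M > 0" unfolding M_def by (simp add: add_nonneg_pos)
  define d where "d = min r d1 / M"
  have "d > 0" using r d1 M by (simp add: d_def)
  moreover have "\<bar>f (x + t *\<^sub>R u + t *\<^sub>R v) - f (x + t *\<^sub>R u) - f (x + t *\<^sub>R v) + f x
       - t\<^sup>2 * (hessian f x v \<bullet> u)\<bar> \<le> e * t\<^sup>2" if t: "0 < t" "t < d" for t
  proof -
    have tM: "t * M < min r d1" using t M by (simp add: d_def field_simps)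
    have small: "norm (s *\<^sub>R u + c *\<^sub>R v) < min r d1"
      if "0 \<le> s" "s \<le> t" "0 \<le> c" "c \<le> t" for s c
    proof -
      have "norm (s *\<^sub>R u + c *\<^sub>R v) \<le> s * norm u + c * norm v"
        using norm_triangle_ineq[of "s *\<^sub>R u" "c *\<^sub>R v"] that by simp
      also have "\<dots> \<le> t * norm u + t * norm v"
        using that by (intro add_mono mult_right_mono) auto
      also have "\<dots> \<le> t * M" using t by (simp add: M_def algebra_simps)
      finally show ?thesis using tM by simp
    qed
    define \<phi> where "\<phi> = (\<lambda>s. f (x + s *\<^sub>R u + t *\<^sub>R v) - f (x + s *\<^sub>R u))"
    have der: "(\<phi> has_real_derivative u \<bullet> (grad f (x + s *\<^sub>R u + t *\<^sub>R v) - grad f (x + s *\<^sub>R u))) (at s)"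
      if "0 \<le> s" "s \<le> t" for s
    proof -
      have "f differentiable (at (x + s *\<^sub>R u + c *\<^sub>R v))" if "0 \<le> c" "c \<le> t" for c
        proof (rule f)
        have "norm (x - (x + s *\<^sub>R u + c *\<^sub>R v)) = norm (s *\<^sub>R u + c *\<^sub>R v)"
          by (subst norm_minus_commute) (simp add: add.assoc)
        then show "x + s *\<^sub>R u + c *\<^sub>R v \<in> ball x r"
          using small[OF \<open>0 \<le> s\<close> \<open>s \<le> t\<close> that] by (simp add: dist_norm)
      qed
      note D = has_derivative_grad[OF this]
      have "((\<lambda>s. f (x + s *\<^sub>R u + c *\<^sub>R v)) has_derivative (\<lambda>h. (h *\<^sub>R u) \<bullet> grad f (x + s *\<^sub>R u + c *\<^sub>R v))) (at s)"
        if "0 \<le> c" "c \<le> t" for c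
        by (rule has_derivative_compose[of "\<lambda>s. x + s *\<^sub>R u + c *\<^sub>R v" "\<lambda>h. h *\<^sub>R u", OF _ D[OF that]])
           (auto intro!: derivative_eq_intros)
      from has_derivative_diff[OF this[of t] this[of 0]] t
      show ?thesis unfolding has_field_derivative_def \<phi>_def
        by (auto elim!: has_derivative_eq_rhs simp: inner_diff_right algebra_simps)
    qed
    obtain \<sigma> where \<sigma>: "0 < \<sigma>" "\<sigma> < t"
      "\<phi> t - \<phi> 0 = (t - 0) * (u \<bullet> (grad f (x + \<sigma> *\<^sub>R u + t *\<^sub>R v) - grad f (x + \<sigma> *\<^sub>R u)))"
      using MVT2[of 0 t \<phi>, OF _ der] t by auto
    define E where "E = (\<lambda>y. grad f y - grad f x - hessian f x (y - x))"
    define a b where "a = x + \<sigma> *\<^sub>R u + t *\<^sub>R v" and "b = x + \<sigma> *\<^sub>R u"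
    have "norm (E a) \<le> e / L * norm (a - x)" "norm (E b) \<le> e / L * norm (b - x)"
      unfolding E_def using \<sigma> t small[of \<sigma> t] small[of \<sigma> 0]
      by (intro d1(2); simp add: a_def b_def add.assoc)+
    moreover have "norm (a - x) \<le> t * (norm u + norm v)"
    proof -
      have "norm (a - x) \<le> \<sigma> * norm u + t * norm v"
        using norm_triangle_ineq[of "\<sigma> *\<^sub>R u" "t *\<^sub>R v"] \<sigma> t by (simp add: a_def add.assoc)
      also have "\<dots> \<le> t * norm u + t * norm v"
        using \<sigma> by (intro add_mono mult_right_mono) auto
      finally show ?thesis by (simp add: algebra_simps)
    qed
    moreover have "norm (b - x) \<le> t * norm u"
      using \<sigma> by (simp add: b_def mult_right_mono)
    moreover have eL: "e / L > 0" using e L by simp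
    ultimately have Eab: "norm (E a) \<le> e / L * (t * (norm u + norm v))" "norm (E b) \<le> e / L * (t * norm u)"
      by (meson less_imp_le mult_left_mono order_trans)+
    have "norm (E a - E b) \<le> e / L * (t * (norm u + norm v)) + e / L * (t * norm u)"
      using norm_triangle_ineq4[of "E a" "E b"] Eab by linarith
    also have "\<dots> = e / L * t * (2 * norm u + norm v)" by (simp add: algebra_simps)
    finally have EE: "norm (E a - E b) \<le> e / L * t * (2 * norm u + norm v)" .
    have ab: "a - x = (b - x) + t *\<^sub>R v" by (simp add: a_def b_def)
    have G: "grad f a - grad f b = t *\<^sub>R hessian f x v + (E a - E b)"
      unfolding E_def ab H.add H.scale by simp
    have "f (x + t *\<^sub>R u + t *\<^sub>R v) - f (x + t *\<^sub>R u) - f (x + t *\<^sub>R v) + f x = \<phi> t - \<phi> 0"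
      by (simp add: \<phi>_def)
    also have "\<dots> = t * (u \<bullet> (grad f a - grad f b))" using \<sigma> by (simp add: a_def b_def)
    also have "\<dots> = t\<^sup>2 * (hessian f x v \<bullet> u) + t * (u \<bullet> (E a - E b))"
      unfolding G by (simp add: inner_add_right power2_eq_square inner_commute algebra_simps)
    finally have "\<bar>f (x + t *\<^sub>R u + t *\<^sub>R v) - f (x + t *\<^sub>R u) - f (x + t *\<^sub>R v) + f x
       - t\<^sup>2 * (hessian f x v \<bullet> u)\<bar> = t * \<bar>u \<bullet> (E a - E b)\<bar>" using t by (simp add: abs_mult)
    also have "\<dots> \<le> t * (norm u * (e / L * t * (2 * norm u + norm v)))"
      using t by (intro mult_left_mono order_trans[OF Cauchy_Schwarz_ineq2] EE) auto
    also have "\<dots> = (e / L) * t\<^sup>2 * (L - 1)" by (simp add: L_def power2_eq_square algebra_simps)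
    also have "\<dots> \<le> (e / L) * t\<^sup>2 * L"
      by (intro mult_left_mono mult_nonneg_nonneg) (use eL in simp_all)
    also have "\<dots> = e * t\<^sup>2" using L by simp
    finally show ?thesis .
  qed
  ultimately show ?thesis by blast
qed

lemma hessian_symmetric:
  assumes r: "r > 0" and f: "\<And>y. y \<in> ball x r \<Longrightarrow> f differentiable (at y)"
    and g: "grad f differentiable (at x)"
  shows "hessian f x u \<bullet> v = hessian f x v \<bullet> u"
proof (rule ccontr)
  assume ne: "hessian f x u \<bullet> v \<noteq> hessian f x v \<bullet> u"
  define e where "e = \<bar>hessian f x u \<bullet> v - hessian f x v \<bullet> u\<bar> / 3"
  have e: "e > 0" using ne by (simp add: e_def)
  obtain d1 where d1: "d1 > 0" "\<And>t. 0 < t \<Longrightarrow> t < d1 \<Longrightarrow>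
    \<bar>f (x + t *\<^sub>R u + t *\<^sub>R v) - f (x + t *\<^sub>R u) - f (x + t *\<^sub>R v) + f x
       - t\<^sup>2 * (hessian f x v \<bullet> u)\<bar> \<le> e * t\<^sup>2"
    using mixed_difference_approx[OF r f g e, of u v] by blast
  obtain d2 where d2: "d2 > 0" "\<And>t. 0 < t \<Longrightarrow> t < d2 \<Longrightarrow>
    \<bar>f (x + t *\<^sub>R v + t *\<^sub>R u) - f (x + t *\<^sub>R v) - f (x + t *\<^sub>R u) + f x
       - t\<^sup>2 * (hessian f x u \<bullet> v)\<bar> \<le> e * t\<^sup>2"
    using mixed_difference_approx[OF r f g e, of v u] by blast
  define t where "t = min d1 d2 / 2"
  have t: "0 < t" "t < d1" "t < d2" using d1 d2 by (auto simp: t_def)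
  have sw: "x + t *\<^sub>R v + t *\<^sub>R u = x + t *\<^sub>R u + t *\<^sub>R v" by (simp add: algebra_simps)
  have "\<bar>t\<^sup>2 * (hessian f x u \<bullet> v) - t\<^sup>2 * (hessian f x v \<bullet> u)\<bar> \<le> 2 * (e * t\<^sup>2)"
    using d1(2)[OF t(1,2)] d2(2)[OF t(1,3)] unfolding sw by linarith
  then have "t\<^sup>2 * \<bar>hessian f x u \<bullet> v - hessian f x v \<bullet> u\<bar> \<le> t\<^sup>2 * (2 * e)"
    by (simp add: abs_mult mult.commute mult.left_commute flip: right_diff_distrib)
  then have "\<bar>hessian f x u \<bullet> v - hessian f x v \<bullet> u\<bar> \<le> 2 * e"
    using t by (simp add: mult_le_cancel_left)
  then show False using e by (simp add: e_def)
qed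

text \<open>Continuity of \<open>hessian f y h\<close> in \<open>y\<close> for each fixed \<open>h\<close> becomes continuity in operator norm by
summing over the finitely many basis vectors.\<close>

lemma hessian_operator_continuous:
  assumes f: "C2_on f W" and W: "open W" "x \<in> W" and e: "e > 0"
  shows "\<exists>r>0. ball x r \<subseteq> W \<and> (\<forall>y\<in>ball x r. \<forall>w. norm (hessian f y w - hessian f x w) \<le> e * norm w)"
proof -
  define h where "h = (\<lambda>y. \<Sum>b\<in>Basis. norm (hessian f y b - hessian f x b))"
  have "continuous_on W h"
    unfolding h_def using f by (intro continuous_intros) (auto simp: C2_on_def)
  then have "isCont h x" using W continuous_on_eq_continuous_at by blast
  moreover have "h x = 0" by (simp add: h_def)
  ultimately obtain r1 where r1: "r1 > 0" "\<And>y. dist y x < r1 \<Longrightarrow> \<bar>h y\<bar> < e"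
    using e unfolding continuous_at_eps_delta by (auto simp: dist_real_def)
  obtain r2 where r2: "r2 > 0" "ball x r2 \<subseteq> W" using W openE by blast
  have "norm (hessian f y w - hessian f x w) \<le> e * norm w" if "y \<in> ball x (min r1 r2)" for y w
  proof -
    have y: "y \<in> W" using that r2 by auto
    have bl: "bounded_linear (hessian f z)" if "z \<in> W" for z
      using f that by (auto simp: C2_on_def intro: has_derivative_bounded_linear has_derivative_hessian)
    interpret B: bounded_linear "\<lambda>w. hessian f y w - hessian f x w"
      by (intro bounded_linear_sub bl y W)
    have "norm (hessian f y w - hessian f x w)
        = norm (\<Sum>b\<in>Basis. (w \<bullet> b) *\<^sub>R (hessian f y b - hessian f x b))"
      using B.sum[of "\<lambda>b. (w \<bullet> b) *\<^sub>R b" Basis] by (simp add: euclidean_representation B.scale)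
    also have "\<dots> \<le> (\<Sum>b\<in>Basis. norm w * norm (hessian f y b - hessian f x b))"
      by (rule sum_norm_le) (auto intro!: mult_right_mono Basis_le_norm)
    also have "\<dots> = h y * norm w" by (simp add: h_def sum_distrib_left mult.commute)
    also have "\<dots> \<le> e * norm w"
      using r1(2)[of y] that by (intro mult_right_mono) (auto simp: dist_commute)
    finally show ?thesis .
  qed
  then show ?thesis using r1 r2 by (intro exI[of _ "min r1 r2"]) auto
qed

section \<open>Supporting half-spaces and the outer normal\<close>

lemma C2_defining_function_recenter:
  assumes "C2_defining_function D \<xi> W \<rho>" "p \<in> W"
  shows "C2_defining_function D p W \<rho>"
  using assms by (auto simp: C2_defining_function_def)

lemma C2_defining_functionD:
  assumes "C2_defining_function D p W \<rho>" "p \<in> frontier D"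
  shows "open W" "p \<in> W" "C2_on \<rho> W" "\<rho> p = 0" "grad \<rho> p \<noteq> 0" "\<rho> differentiable (at p)"
    "\<And>y. y \<in> W \<Longrightarrow> y \<in> D \<longleftrightarrow> \<rho> y < 0"
  using assms by (auto simp: C2_defining_function_def C2_on_def)

lemma directional_derivative:
  assumes "f differentiable (at p)"
  shows "((\<lambda>t. f (p + t *\<^sub>R w)) has_real_derivative w \<bullet> grad f p) (at 0)"
proof -
  have D: "(f has_derivative (\<lambda>h. h \<bullet> grad f p)) (at (p + 0 *\<^sub>R w))"
    using has_derivative_grad[OF assms] by simp
  have "((\<lambda>t. f (p + t *\<^sub>R w)) has_derivative (\<lambda>h. (h *\<^sub>R w) \<bullet> grad f p)) (at 0)"
    by (rule has_derivative_compose[of "\<lambda>t. p + t *\<^sub>R w" "\<lambda>h. h *\<^sub>R w", OF _ D])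
      (auto intro!: derivative_eq_intros)
  then show ?thesis
    unfolding has_field_derivative_def by (rule has_derivative_eq_rhs) auto
qed

lemma ray_stays_in_open:
  fixes p w :: "'a::real_normed_vector"
  assumes "open W" "p \<in> W"
  shows "\<exists>d>0. \<forall>t. 0 < t \<and> t < d \<longrightarrow> p + t *\<^sub>R w \<in> W"
proof -
  obtain e where e: "e > 0" "ball p e \<subseteq> W" using assms openE by blast
  have n: "norm w + 1 > 0" by (simp add: add_nonneg_pos)
  have "p + t *\<^sub>R w \<in> W" if t: "0 < t" "t < e / (norm w + 1)" for t
  proof -
    have "t * norm w \<le> t * (norm w + 1)" using t by simp
    also have "\<dots> < e" using t n by (simp add: field_simps)
    finally show ?thesis using t e by (auto simp: dist_norm)
  qed
  then show ?thesis using e n by (intro exI[of _ "e / (norm w + 1)"]) auto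
qed

text \<open>The domain contains every direction of the open half-space of first-order descent. Together with
\<open>convex_domain_below_tangent\<close> this identifies the tangent half-space from the domain alone.\<close>

lemma inward_ray_in_domain:
  assumes \<rho>: "C2_defining_function D p W \<rho>" and p: "p \<in> frontier D" and w: "w \<bullet> grad \<rho> p < 0"
  shows "\<exists>t>0. p + t *\<^sub>R w \<in> D"
proof -
  note F = C2_defining_functionD[OF \<rho> p]
  obtain d1 where d1: "d1 > 0" "\<And>t. 0 < t \<Longrightarrow> t < d1 \<Longrightarrow> \<rho> (p + t *\<^sub>R w) < \<rho> p"
    using DERIV_neg_dec_right[OF directional_derivative[OF F(6)] w] by auto
  obtain d2 where d2: "d2 > 0" "\<And>t. 0 < t \<Longrightarrow> t < d2 \<Longrightarrow> p + t *\<^sub>R w \<in> W"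
    using ray_stays_in_open[OF F(1,2)] by blast
  define t where "t = min d1 d2 / 2"
  have "0 < t" "t < d1" "t < d2" using d1 d2 by (auto simp: t_def)
  then show ?thesis using d1 d2 F by (metis)
qed

text \<open>The segment from \<open>p\<close> to a point of \<open>D\<close> stays in \<open>D\<close>, so \<open>\<rho>\<close> cannot increase along it at first order.\<close>

lemma convex_domain_below_tangent:
  assumes D: "open D" "convex D"
    and \<rho>: "C2_defining_function D p W \<rho>" and p: "p \<in> frontier D" and y: "y \<in> D"
  shows "(y - p) \<bullet> grad \<rho> p \<le> 0"
proof (rule ccontr)
  assume "\<not> ?thesis"
  then have pos: "(y - p) \<bullet> grad \<rho> p > 0" by simp
  note F = C2_defining_functionD[OF \<rho> p]
  obtain d1 where d1: "d1 > 0" "\<And>t. 0 < t \<Longrightarrow> t < d1 \<Longrightarrow> \<rho> p < \<rho> (p + t *\<^sub>R (y - p))"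
    using DERIV_pos_inc_right[OF directional_derivative[OF F(6)] pos] by auto
  obtain d2 where d2: "d2 > 0" "\<And>t. 0 < t \<Longrightarrow> t < d2 \<Longrightarrow> p + t *\<^sub>R (y - p) \<in> W"
    using ray_stays_in_open[OF F(1,2)] by blast
  define t where "t = min 1 (min d1 d2) / 2"
  have t: "0 < t" "t < d1" "t < d2" "t < 1" using d1 d2 by (auto simp: t_def)
  have "y \<noteq> p" using y p D by (auto simp: frontier_def interior_open)
  have "p + t *\<^sub>R (y - p) \<in> open_segment y p"
    unfolding in_segment using \<open>y \<noteq> p\<close> t by (auto intro!: exI[of _ "1 - t"] simp: algebra_simps)
  moreover have "open_segment y p \<subseteq> interior D"
    using D y p by (intro in_interior_closure_convex_segment) (auto simp: interior_open frontier_def)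
  ultimately have "p + t *\<^sub>R (y - p) \<in> D" using interior_subset by blast
  then show False using F d1(2)[OF t(1,2)] d2(2)[OF t(1,3)] by auto
qed

text \<open>Any defining function computes the normal: if two unit normals \<open>a \<noteq> b\<close> arose, the direction \<open>a - b\<close>
would point into the domain according to \<open>b\<close> and out of the half-space that supports it at \<open>p\<close>
according to \<open>a\<close>.\<close>

lemma outer_normal_eq:
  assumes D: "open D" "convex D"
    and \<rho>: "C2_defining_function D p W \<rho>" and p: "p \<in> frontier D"
  shows "outer_normal D p = grad \<rho> p /\<^sub>R norm (grad \<rho> p)"
proof -
  let ?n = "\<lambda>\<rho>. grad \<rho> p /\<^sub>R norm (grad \<rho> p)"
  have "\<exists>W \<rho>'. C2_defining_function D p W \<rho>' \<and> outer_normal D p = ?n \<rho>'"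
    unfolding outer_normal_def by (rule someI_ex) (use \<rho> in blast)
  then obtain W' \<rho>' where \<rho>': "C2_defining_function D p W' \<rho>'" "outer_normal D p = ?n \<rho>'" by blast
  note F = C2_defining_functionD[OF \<rho> p] and F' = C2_defining_functionD[OF \<rho>'(1) p]
  define a b where "a = ?n \<rho>" and "b = ?n \<rho>'"
  have ab: "norm a = 1" "norm b = 1" using F(5) F'(5) by (simp_all add: a_def b_def)
  have g: "grad \<rho> p = norm (grad \<rho> p) *\<^sub>R a" "grad \<rho>' p = norm (grad \<rho>' p) *\<^sub>R b"
    using F(5) F'(5) by (simp_all add: a_def b_def)
  have aa: "a \<bullet> a = 1" "b \<bullet> b = 1" using ab by (simp_all add: norm_eq_1)
  have "a = b"
  proof (rule ccontr)
    assume "a \<noteq> b"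
    have "(a - b) \<bullet> (a - b) > 0" using \<open>a \<noteq> b\<close> by simp
    then have lt: "a \<bullet> b < 1"
      using aa by (simp add: inner_diff_left inner_diff_right inner_commute)
    have "(a - b) \<bullet> grad \<rho>' p = norm (grad \<rho>' p) * (a \<bullet> b - 1)"
      by (subst g(2)) (simp add: inner_diff_left aa)
    also have "\<dots> < 0" using lt F'(5) by (simp add: mult_less_0_iff)
    finally obtain t where t: "t > 0" "p + t *\<^sub>R (a - b) \<in> D"
      using inward_ray_in_domain[OF \<rho>'(1) p] by blast
    have "t * (norm (grad \<rho> p) * (1 - a \<bullet> b)) = (p + t *\<^sub>R (a - b) - p) \<bullet> grad \<rho> p"
      by (subst (2) g(1)) (simp add: inner_diff_left aa inner_commute[of b a])
    also have "\<dots> \<le> 0" by (rule convex_domain_below_tangent[OF D \<rho> p t(2)])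
    finally show False using t lt F(5) by (simp add: mult_le_0_iff)
  qed
  then show ?thesis using \<rho>'(2) by (simp add: a_def b_def)
qed

lemma norm_outer_normal:
  assumes "open D" "convex D" "C2_boundary_point D p"
  shows "norm (outer_normal D p) = 1"
proof -
  obtain W \<rho> where \<rho>: "p \<in> frontier D" "C2_defining_function D p W \<rho>"
    using assms by (auto simp: C2_boundary_point_def)
  show ?thesis
    using outer_normal_eq[OF assms(1,2) \<rho>(2,1)] C2_defining_functionD(5)[OF \<rho>(2,1)] by simp
qed

text \<open>Strictness comes from openness: a point of \<open>D\<close> on the supporting hyperplane could be pushed across it.\<close>

lemma supporting_halfspace:
  assumes D: "open D" "convex D" and p: "C2_boundary_point D p" and y: "y \<in> D"
  shows "(y - p) \<bullet> outer_normal D p < 0"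
proof -
  let ?n = "outer_normal D p"
  obtain W \<rho> where \<rho>: "p \<in> frontier D" "C2_defining_function D p W \<rho>"
    using p by (auto simp: C2_boundary_point_def)
  have le: "(z - p) \<bullet> ?n \<le> 0" if "z \<in> D" for z
    using convex_domain_below_tangent[OF D \<rho>(2,1) that]
    unfolding outer_normal_eq[OF D \<rho>(2,1)] by (simp add: mult_le_0_iff divide_inverse)
  have n: "?n \<bullet> ?n = 1" using norm_outer_normal[OF D p] by (simp add: norm_eq_1)
  obtain d where "d > 0" "\<forall>t. 0 < t \<and> t < d \<longrightarrow> y + t *\<^sub>R ?n \<in> D"
    using ray_stays_in_open[OF D(1) y] by blast
  then have "d / 2 > 0" "y + (d / 2) *\<^sub>R ?n \<in> D" by auto
  from this(1) le[OF this(2)] show ?thesis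
    by (simp add: inner_add_left inner_diff_left n)
qed

section \<open>Nearest boundary points and interior balls\<close>

lemma segment_meets_frontier:
  fixes x y :: "'a::real_normed_vector"
  assumes "x \<in> D" "y \<notin> D"
  obtains z where "z \<in> closed_segment x y" "z \<in> frontier D"
  using connected_Int_frontier[of "closed_segment x y" D] assms by auto

lemma bdist_le: "y \<in> frontier D \<Longrightarrow> bdist D x \<le> dist x y"
  unfolding bdist_def by (rule infdist_le)

lemma bdist_pos:
  assumes "open D" "x \<in> D" "frontier D \<noteq> {}"
  shows "bdist D x > 0"
proof -
  have "x \<notin> frontier D" using assms by (auto simp: frontier_def interior_open)
  then show ?thesis
    unfolding bdist_def using assms infdist_pos_not_in_closed[OF frontier_closed] by blast
qed

lemma ball_bdist_subset:
  assumes "x \<in> D"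
  shows "ball x (bdist D x) \<subseteq> D"
proof
  fix y assume y: "y \<in> ball x (bdist D x)"
  show "y \<in> D"
  proof (rule ccontr)
    assume "y \<notin> D"
    then obtain z where z: "z \<in> closed_segment x y" "z \<in> frontier D"
      using assms segment_meets_frontier by blast
    have "dist x z \<le> dist x y" using segment_bound1[OF z(1)] by (simp add: dist_norm norm_minus_commute)
    then show False using bdist_le[OF z(2), of x] y by simp
  qed
qed

lemma nearest_boundary_point:
  assumes "frontier D \<noteq> {}"
  shows "closest_point (frontier D) x \<in> frontier D" "dist x (closest_point (frontier D) x) = bdist D x"
proof -
  show *: "closest_point (frontier D) x \<in> frontier D"
    by (rule closest_point_in_set[OF frontier_closed assms])
  have "dist x (closest_point (frontier D) x) \<le> bdist D x"
    unfolding bdist_def infdist_def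
    using assms closest_point_le[OF frontier_closed] by (auto intro!: cINF_greatest)
  then show "dist x (closest_point (frontier D) x) = bdist D x"
    using bdist_le[OF *, of x] by simp
qed


lemma nearest_boundary_point_near:
  assumes "p \<in> frontier D" "dist x p = bdist D x" "\<xi> \<in> frontier D" "x \<in> ball \<xi> r"
  shows "p \<in> ball \<xi> (2 * r)"
  using bdist_le[OF assms(3), of x] assms dist_triangle[of \<xi> p x] by (simp add: dist_commute)

text \<open>This is the equality case of the Cauchy-Schwarz inequality.\<close>

lemma norm_inner_unit_eq:
  fixes a n :: "'a::real_inner"
  assumes "norm n = 1" "norm a = \<delta>" "a \<bullet> n \<ge> \<delta>"
  shows "a = \<delta> *\<^sub>R n"
proof -
  have "(a - \<delta> *\<^sub>R n) \<bullet> (a - \<delta> *\<^sub>R n) = a \<bullet> a - 2 * \<delta> * (a \<bullet> n) + \<delta> * \<delta> * (n \<bullet> n)"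
    by (simp add: inner_diff_left inner_diff_right inner_commute algebra_simps)
  also have "\<dots> = 2 * \<delta> * (\<delta> - a \<bullet> n)"
    using assms by (simp add: dot_square_norm power2_eq_square algebra_simps)
  also have "\<dots> \<le> 0" using assms norm_ge_zero[of a] by (simp add: mult_le_0_iff)
  finally show ?thesis by (simp add: inner_gt_zero_iff not_less[symmetric])
qed

text \<open>The ball of radius \<open>bdist D x\<close> about \<open>x\<close> lies in \<open>D\<close>, hence in the supporting half-space at \<open>p\<close>. Its
centre therefore has distance at least \<open>bdist D x\<close> from the hyperplane, and \<open>p - x\<close> has exactly
this length, so it is normal.\<close>

lemma nearest_boundary_point_along_normal:
  assumes D: "open D" "convex D" and x: "x \<in> D" and p: "C2_boundary_point D p"
    and d: "dist x p = bdist D x"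
  shows "p - x = bdist D x *\<^sub>R outer_normal D p"
proof (rule norm_inner_unit_eq)
  let ?n = "outer_normal D p" and ?\<delta> = "bdist D x"
  show n: "norm ?n = 1" by (rule norm_outer_normal[OF D p])
  show nm: "norm (p - x) = ?\<delta>" using d by (simp add: dist_norm norm_minus_commute)
  show "(p - x) \<bullet> ?n \<ge> ?\<delta>"
  proof (rule ccontr)
    assume "\<not> ?thesis"
    then have lt: "(p - x) \<bullet> ?n < ?\<delta>" by simp
    have ge: "(p - x) \<bullet> ?n \<ge> - ?\<delta>"
      using Cauchy_Schwarz_ineq2[of "p - x" ?n] n nm by simp
    \<comment> \<open>Otherwise the midpoint of the two values gives a point of the ball beyond the hyperplane.\<close>
    define s where "s = ((p - x) \<bullet> ?n + ?\<delta>) / 2"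
    have "0 \<le> s" "s < ?\<delta>" "(p - x) \<bullet> ?n < s" using lt ge by (auto simp: s_def)
    then have "x + s *\<^sub>R ?n \<in> ball x ?\<delta>" by (simp add: dist_norm n)
    then have "x + s *\<^sub>R ?n \<in> D" using ball_bdist_subset[OF x] by blast
    from supporting_halfspace[OF D p this] have "s - (p - x) \<bullet> ?n < 0"
      using n by (simp add: inner_diff_left inner_add_left norm_eq_1)
    then show False using \<open>(p - x) \<bullet> ?n < s\<close> by simp
  qed
qed

text \<open>A ball tangent from inside at \<open>p\<close> consists of points \<open>p + w\<close> with
\<open>(norm w)\<^sup>2 < - 2 * R * (w \<bullet> n)\<close>. With a common bound \<open>M\<close> for the Hessian near \<open>\<xi>\<close>, the linear term
of \<open>\<rho>\<close> at \<open>p\<close> dominates the quadratic one on such points as soon as \<open>M * R \<le> norm (grad \<rho> p)\<close>, so one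
radius serves all boundary points near \<open>\<xi>\<close>.\<close>

lemma uniform_interior_ball:
  assumes D: "open D" "convex D"
    and \<rho>: "C2_defining_function D \<xi> W \<rho>" and \<xi>: "\<xi> \<in> frontier D"
  shows "\<exists>R>0. \<exists>r>0. ball \<xi> r \<subseteq> W \<and>
    (\<forall>p \<in> frontier D \<inter> ball \<xi> r. ball (p - R *\<^sub>R outer_normal D p) R \<subseteq> D)"
proof -
  note F = C2_defining_functionD[OF \<rho> \<xi>]
  have dg: "grad \<rho> differentiable (at \<xi>)" using F by (auto simp: C2_on_def)
  obtain r0 where r0: "r0 > 0" "ball \<xi> r0 \<subseteq> W"
    "\<And>y w. y \<in> ball \<xi> r0 \<Longrightarrow> norm (hessian \<rho> y w - hessian \<rho> \<xi> w) \<le> 1 * norm w"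
    using hessian_operator_continuous[OF F(3,1,2), of 1] by auto
  obtain K where K: "K > 0" "\<And>w. norm (hessian \<rho> \<xi> w) \<le> norm w * K"
    using bounded_linear.pos_bounded[OF has_derivative_bounded_linear[OF has_derivative_hessian[OF dg]]]
    by blast
  define M where "M = K + 1"
  have M: "M > 0" using K by (simp add: M_def)
  have HM: "hessian \<rho> y w \<bullet> w \<le> M * (norm w)\<^sup>2" if "y \<in> ball \<xi> r0" for y w
  proof -
    have "hessian \<rho> y w \<bullet> w \<le> norm (hessian \<rho> y w) * norm w" by (rule norm_cauchy_schwarz)
    also have "norm (hessian \<rho> y w) \<le> M * norm w"
      using r0(3)[OF that, of w] K(2)[of w] norm_triangle_sub[of "hessian \<rho> y w" "hessian \<rho> \<xi> w"]
      by (simp add: M_def algebra_simps)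
    finally show ?thesis by (simp add: power2_eq_square mult_right_mono)
  qed
  define g where "g = norm (grad \<rho> \<xi>)"
  have g: "g > 0" using F(5) by (simp add: g_def)
  have "isCont (\<lambda>y. norm (grad \<rho> y)) \<xi>"
    using dg by (intro continuous_norm differentiable_imp_continuous_within)
  then obtain r1 where r1: "r1 > 0" "\<And>y. dist y \<xi> < r1 \<Longrightarrow> \<bar>norm (grad \<rho> y) - g\<bar> < g / 2"
    using g unfolding continuous_at_eps_delta g_def dist_real_def
    by (meson half_gt_zero)
  \<comment> \<open>The first bound makes the gradient win, where \<open>g / 2\<close> bounds it from below near \<open>\<xi>\<close>; the second
  keeps the ball where the Hessian bound holds.\<close>
  define R where "R = min (g / (2 * M)) (r0 / 4)"
  have R: "R > 0" "2 * R \<le> r0 / 2" "M * R \<le> g / 2"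
    using M g r0(1) by (auto simp: R_def min_def field_simps)
  define r where "r = min (r0 / 2) r1"
  have r: "r > 0" "r \<le> r0 / 2" "r \<le> r1" using r0 r1 by (auto simp: r_def)
  have "y \<in> D" if p: "p \<in> frontier D" "p \<in> ball \<xi> r" and y: "y \<in> ball (p - R *\<^sub>R outer_normal D p) R" for p y
  proof -
    let ?n = "outer_normal D p"
    have pW: "p \<in> W" using p r r0 by auto
    note \<rho>p = C2_defining_function_recenter[OF \<rho> pW]
    have n: "norm ?n = 1" using norm_outer_normal[OF D] \<rho>p p by (auto simp: C2_boundary_point_def)
    have gp: "grad \<rho> p = norm (grad \<rho> p) *\<^sub>R ?n"
      using outer_normal_eq[OF D \<rho>p p(1)] C2_defining_functionD(5)[OF \<rho>p p(1)] by simp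
    have "norm (grad \<rho> p) > g / 2" using r1(2)[of p] p r unfolding mem_ball dist_commute[of \<xi>] by linarith
    define w where "w = y - p"
    have "norm (w + R *\<^sub>R ?n) < R" using y by (simp add: w_def dist_norm norm_minus_commute algebra_simps)
    then have "(norm (w + R *\<^sub>R ?n))\<^sup>2 < R\<^sup>2" by (simp add: power_strict_mono)
    also have "(norm (w + R *\<^sub>R ?n))\<^sup>2 = (norm w)\<^sup>2 + 2 * R * (w \<bullet> ?n) + R\<^sup>2"
      unfolding power2_norm_eq_inner inner_add_left inner_add_right inner_scaleR_left inner_scaleR_right
      using n by (simp add: inner_commute norm_eq_1 power2_eq_square distrib_left)
    finally have q: "(norm w)\<^sup>2 < 2 * R * (- (w \<bullet> ?n))" by simp
    then have wn: "w \<bullet> ?n < 0"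
      using R by (smt (verit) mult_nonneg_nonneg zero_le_power2 mult_minus_right)
    have "norm w \<le> norm (w + R *\<^sub>R ?n) + norm (R *\<^sub>R ?n)" using norm_triangle_ineq4[of "w + R *\<^sub>R ?n" "R *\<^sub>R ?n"] by simp
    then have nw: "norm w < r0 / 2" using \<open>norm (w + R *\<^sub>R ?n) < R\<close> n R by simp
    have seg: "closed_segment p (p + w) \<subseteq> ball \<xi> r0"
    proof
      fix z assume "z \<in> closed_segment p (p + w)"
      then have "norm (z - p) \<le> norm w" using segment_bound1 by fastforce
      then show "z \<in> ball \<xi> r0"
        using nw p(2) r dist_triangle[of \<xi> z p] by (auto simp: dist_norm norm_minus_commute)
    qed
    obtain z where z: "z \<in> closed_segment p (p + w)"
      "\<rho> (p + w) = \<rho> p + w \<bullet> grad \<rho> p + (hessian \<rho> z w \<bullet> w) / 2"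
      using second_order_Taylor[OF F(3) order_trans[OF seg r0(2)]] .
    have "hessian \<rho> z w \<bullet> w \<le> M * (norm w)\<^sup>2" using HM z seg by blast
    also have "\<dots> < M * (2 * R * (- (w \<bullet> ?n)))" using q M by (rule mult_strict_left_mono)
    also have "\<dots> = 2 * ((M * R) * (- (w \<bullet> ?n)))" by simp
    also have "\<dots> \<le> 2 * (norm (grad \<rho> p) * (- (w \<bullet> ?n)))"
      using wn R \<open>norm (grad \<rho> p) > g / 2\<close> by (intro mult_left_mono mult_right_mono) auto
    also have "\<dots> = - 2 * (w \<bullet> grad \<rho> p)" by (subst (2) gp) simp
    finally have "\<rho> (p + w) < 0"
      using z(2) C2_defining_functionD(4)[OF \<rho>p p(1)] by simp
    moreover have "p + w \<in> W" using seg r0(2) by auto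
    ultimately show "y \<in> D" using F(7) by (auto simp: w_def)
  qed
  then show ?thesis using R(1) r r0(2) by (intro exI[of _ R] exI[of _ r] conjI) auto
qed

lemma interior_ball_inner_bound:
  fixes p x y n :: "'a::real_inner"
  assumes "y \<notin> ball (p - R *\<^sub>R n) R" "p - x = \<delta> *\<^sub>R n" "norm n = 1" "R > 0"
  shows "2 * R * \<delta> - \<delta>\<^sup>2 \<le> (norm (y - x))\<^sup>2 + 2 * (R - \<delta>) * ((y - x) \<bullet> n)"
proof -
  have n: "n \<bullet> n = 1" using assms(3) by (simp add: norm_eq_1)
  have "R \<le> norm (y - (p - R *\<^sub>R n))" using assms(1) by (simp add: dist_norm norm_minus_commute)
  also have "y - (p - R *\<^sub>R n) = (y - x) + (R - \<delta>) *\<^sub>R n"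
    using assms(2) by (simp add: algebra_simps)
  finally have "R\<^sup>2 \<le> (norm ((y - x) + (R - \<delta>) *\<^sub>R n))\<^sup>2" using assms(4) by (intro power_mono) auto
  also have "\<dots> = (norm (y - x))\<^sup>2 + 2 * (R - \<delta>) * ((y - x) \<bullet> n) + (R - \<delta>)\<^sup>2"
    unfolding power2_norm_eq_inner inner_add_left inner_add_right inner_scaleR_left inner_scaleR_right n
    by (simp add: inner_commute power2_eq_square algebra_simps)
  finally show ?thesis by (simp add: power2_eq_square algebra_simps)
qed

text \<open>The tangent ball of radius \<open>R\<close> at \<open>p\<close> contains the closed ball of radius \<open>bdist D x\<close> about \<open>x\<close> except
for \<open>p\<close> itself, so \<open>p\<close> is the only boundary point at this distance.\<close>

lemma nearest_boundary_point_unique_inside: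
  assumes D: "open D" "convex D" and x: "x \<in> D" and p: "C2_boundary_point D p"
    and d: "dist x p = bdist D x" and R: "bdist D x < R"
    and ball: "ball (p - R *\<^sub>R outer_normal D p) R \<subseteq> D"
    and q: "q \<in> frontier D" "dist x q = bdist D x"
  shows "q = p"
proof -
  let ?n = "outer_normal D p" and ?\<delta> = "bdist D x"
  have \<delta>: "?\<delta> \<ge> 0" using d by (metis zero_le_dist)
  have n: "norm ?n = 1" by (rule norm_outer_normal[OF D p])
  have px: "p - x = ?\<delta> *\<^sub>R ?n" by (rule nearest_boundary_point_along_normal[OF D x p d])
  have nq: "norm (q - x) = ?\<delta>" using q by (simp add: dist_norm norm_minus_commute)
  have "q \<notin> ball (p - R *\<^sub>R ?n) R" using ball q D by (auto simp: frontier_def interior_open)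
  from interior_ball_inner_bound[OF this px n] R \<delta>
  have "2 * R * ?\<delta> - ?\<delta>\<^sup>2 \<le> ?\<delta>\<^sup>2 + 2 * (R - ?\<delta>) * ((q - x) \<bullet> ?n)" by (simp add: nq)
  then have "(R - ?\<delta>) * ?\<delta> \<le> (R - ?\<delta>) * ((q - x) \<bullet> ?n)" by (simp add: power2_eq_square algebra_simps)
  then have "?\<delta> \<le> (q - x) \<bullet> ?n" using R by (simp add: mult_le_cancel_left)
  from norm_inner_unit_eq[OF n nq this] px show ?thesis by (metis diff_add_cancel)
qed

text \<open>From outside, a nearest boundary point is a nearest point of the closed convex set \<open>closure D\<close>.\<close>

lemma nearest_boundary_point_unique_outside:
  fixes x :: "'a::euclidean_space"
  assumes D: "open D" "convex D" and x: "x \<notin> D"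
    and p: "p \<in> frontier D" "dist x p = bdist D x"
    and q: "q \<in> frontier D" "dist x q = bdist D x"
  shows "q = p"
proof -
  have min: "dist x s \<le> dist x y" if s: "s \<in> frontier D" "dist x s = bdist D x" and y: "y \<in> closure D" for s y
  proof (cases "x \<in> closure D")
    case True
    then have "x \<in> frontier D" using x D by (simp add: frontier_def interior_open)
    from bdist_le[OF this, of x] s show ?thesis by (simp add: order_trans[OF _ zero_le_dist])
  next
    case False
    obtain z where z: "z \<in> closed_segment y x" "z \<in> frontier (closure D)"
      using segment_meets_frontier[OF y False] .
    have "dist x z \<le> dist x y" using segment_bound(2)[OF z(1)] by (simp add: dist_norm norm_minus_commute)
    moreover have "z \<in> frontier D" using z(2) by (auto simp: frontier_def dest: interior_mono[OF closure_subset, THEN subsetD])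
    ultimately show ?thesis using bdist_le[of z D x] s by simp
  qed
  show ?thesis
    by (rule any_closest_point_unique[of "closure D" q p x])
       (use D p q min in \<open>auto simp: frontier_def convex_closure\<close>)
qed

section \<open>Distances inside affine slices\<close>

lemma einfdist_le_exit:
  assumes "x \<in> D" "subspace V" "w \<in> V" "x + w \<notin> D"
  shows "einfdist x ((+) x ` V \<inter> frontier D) \<le> ereal (norm w)"
proof -
  obtain z where z: "z \<in> closed_segment x (x + w)" "z \<in> frontier D"
    using segment_meets_frontier[OF assms(1,4)] .
  obtain u where u: "0 \<le> u" "u \<le> 1" "z = (1 - u) *\<^sub>R x + u *\<^sub>R (x + w)"
    using z(1) by (auto simp: in_segment)
  have zu: "z = x + u *\<^sub>R w" using u(3) by (simp add: algebra_simps)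
  have "dist x z \<le> norm w" using u(1,2) by (simp add: zu dist_norm mult_left_le_one_le)
  moreover have "z \<in> (+) x ` V \<inter> frontier D"
    using z(2) zu subspace_scale[OF assms(2,3)] by auto
  ultimately show ?thesis
    unfolding einfdist_def by (intro INF_lower2[of z]) auto
qed

text \<open>The line through \<open>x\<close> in the direction \<open>w\<close> reaches the supporting hyperplane at the nearest boundary
point, hence leaves \<open>D\<close>, within this distance.\<close>

lemma einfdist_le_along_normal:
  assumes D: "open D" "convex D" and x: "x \<in> D" and p: "C2_boundary_point D p"
    and d: "dist x p = bdist D x" and V: "subspace V" "w \<in> V" and w: "w \<bullet> outer_normal D p \<noteq> 0"
  shows "einfdist x ((+) x ` V \<inter> frontier D)
    \<le> ereal (bdist D x * norm w / \<bar>w \<bullet> outer_normal D p\<bar>)"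
proof -
  let ?n = "outer_normal D p" and ?\<delta> = "bdist D x"
  define t where "t = ?\<delta> / (w \<bullet> ?n)"
  have n: "?n \<bullet> ?n = 1" using norm_outer_normal[OF D p] by (simp add: norm_eq_1)
  have "x + t *\<^sub>R w - p = t *\<^sub>R w - ?\<delta> *\<^sub>R ?n"
    using nearest_boundary_point_along_normal[OF D x p d] by (simp add: algebra_simps)
  then have "(x + t *\<^sub>R w - p) \<bullet> ?n = 0" using w n by (simp only: inner_diff_left inner_scaleR_left) (simp add: t_def)
  then have "x + t *\<^sub>R w \<notin> D" using supporting_halfspace[OF D p, of "x + t *\<^sub>R w"] by auto
  from einfdist_le_exit[OF x V(1) subspace_scale[OF V] this]
  show ?thesis using d zero_le_dist[of x p] by (simp add: t_def abs_mult abs_divide)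
qed


lemma k_bdist_ge:
  assumes "subspace V" "dim V = k" "v \<in> V"
    and "\<And>y. y \<in> (+) x ` V \<Longrightarrow> y \<in> frontier D \<Longrightarrow> r \<le> dist x y"
  shows "ereal r \<le> k_bdist k D x v"
  unfolding k_bdist_def
  by (rule SUP_upper2[of V]) (use assms in \<open>auto simp: einfdist_def intro!: INF_greatest\<close>)

lemma k_bdist_le:
  assumes "\<And>V. subspace V \<Longrightarrow> dim V = k \<Longrightarrow> v \<in> V \<Longrightarrow> einfdist x ((+) x ` V \<inter> frontier D) \<le> ereal r"
  shows "k_bdist k D x v \<le> ereal r"
  unfolding k_bdist_def using assms by (auto intro!: SUP_least)

lemma k_quasi_hyperbolic_ge:
  assumes "k_bdist k D x v \<le> ereal r" "0 < k_bdist k D x v"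
  shows "norm v / (2 * r) \<le> k_quasi_hyperbolic k D x v"
proof -
  obtain K where "k_bdist k D x v = ereal K" "0 < K" "K \<le> r"
    using assms by (cases "k_bdist k D x v") auto
  then show ?thesis by (simp add: k_quasi_hyperbolic_def frac_le)
qed

lemma k_quasi_hyperbolic_le:
  assumes "ereal r \<le> k_bdist k D x v" "0 < r"
  shows "k_quasi_hyperbolic k D x v \<le> norm v / (2 * r)"
  using assms by (cases "k_bdist k D x v") (auto simp: k_quasi_hyperbolic_def frac_le)

text \<open>If all of \<open>V\<close> except \<open>v\<close> is chosen orthogonal to \<open>v\<close>, the vectors of \<open>V\<close> are controlled by their
coefficient along \<open>v\<close>.\<close>

lemma subspace_through_vector:
  fixes v :: "'a::euclidean_space"
  assumes v: "v \<noteq> 0" and S: "subspace S" "\<And>s. s \<in> S \<Longrightarrow> s \<bullet> v = 0"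
    and k: "1 \<le> k" "k - 1 \<le> dim S"
  obtains V where "subspace V" "dim V = k" "v \<in> V"
    "\<And>u. u \<in> V \<Longrightarrow> \<exists>a s. s \<in> S \<and> u = a *\<^sub>R v + s"
proof -
  obtain T where T: "subspace T" "T \<subseteq> S" "dim T = k - 1"
    using choose_subspace_of_subspace[OF k(2)] S(1) by (metis span_eq_iff)
  define V where "V = {x + y |x y. x \<in> span {v} \<and> y \<in> T}"
  have "span {v} \<inter> T = {0}"
  proof -
    have "u = 0" if u: "u \<in> span {v}" "u \<in> T" for u
    proof -
      obtain a where a: "u = a *\<^sub>R v" using u(1) by (auto simp: span_singleton)
      have "u \<bullet> v = 0" using S(2) T(2) u(2) by blast
      then show ?thesis using v a by simp
    qed
    then show ?thesis using T(1) span_zero subspace_0 by blast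
  qed
  then have "dim V = k"
    using dim_sums_Int[OF subspace_span[of "{v}"] T(1)] v T(3) k(1) by (simp add: V_def dim_singleton)
  moreover have "subspace V" unfolding V_def by (intro subspace_sums subspace_span T)
  moreover have "v \<in> V" unfolding V_def using T(1) subspace_0 span_base[of v "{v}"] by force
  moreover have "\<exists>a s. s \<in> S \<and> u = a *\<^sub>R v + s" if "u \<in> V" for u
    using that T(2) by (auto simp: V_def span_singleton)
  ultimately show thesis using that by blast
qed

lemma dim_orthogonal_complement_ge:
  fixes A :: "'a::euclidean_space set"
  assumes "finite A"
  shows "DIM('a) - card A \<le> dim {y. \<forall>x\<in>A. y \<bullet> x = 0}"
proof -
  have "dim {y \<in> UNIV. \<forall>x\<in>span A. orthogonal x y} + dim (span A) = dim (UNIV :: 'a set)"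
    by (rule dim_subspace_orthogonal_to_vectors) auto
  moreover have "dim {y \<in> UNIV. \<forall>x\<in>span A. orthogonal x y} \<le> dim {y. \<forall>x\<in>A. y \<bullet> x = 0}"
    by (rule dim_subset) (auto simp: orthogonal_def inner_commute span_base)
  moreover have "dim (span A) \<le> card A" using assms by (simp add: dim_le_card')
  ultimately show ?thesis by simp
qed

lemma norm_normal_part:
  assumes "norm (outer_normal D p) = 1"
  shows "norm (normal_part D p v) = \<bar>v \<bullet> outer_normal D p\<bar>"
    and "(norm (tangential_part D p v))\<^sup>2 = (norm v)\<^sup>2 - (v \<bullet> outer_normal D p)\<^sup>2"
    and "norm (tangential_part D p v) \<le> norm v"
proof -
  let ?n = "outer_normal D p"
  have n: "?n \<bullet> ?n = 1" using assms by (simp add: norm_eq_1)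
  show "norm (normal_part D p v) = \<bar>v \<bullet> ?n\<bar>" using assms by (simp add: normal_part_def)
  show T: "(norm (tangential_part D p v))\<^sup>2 = (norm v)\<^sup>2 - (v \<bullet> ?n)\<^sup>2"
    unfolding power2_norm_eq_inner tangential_part_def normal_part_def
    by (simp add: n inner_diff_left inner_diff_right inner_commute power2_eq_square)
  show "norm (tangential_part D p v) \<le> norm v"
    by (rule power2_le_imp_le) (use T in auto)
qed

section \<open>Directions of positive curvature\<close>

lemma linear_tangential_part: "linear (tangential_part D p)"
  by (rule linearI) (simp_all add: tangential_part_def normal_part_def algebra_simps)

text \<open>Eigenspaces of the symmetric tangential Hessian for different eigenvalues are orthogonal both for
the scalar product and for the Hessian form, so dimensions and lower bounds add up when they are
adjoined one at a time. The clause on vectors \<open>y\<close> orthogonal to all eigenspaces carries the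
orthogonality of \<open>P\<close> to the next eigenspace through the induction; it says that \<open>P\<close> lies in the
span of the eigenspaces.\<close>

lemma positive_definite_subspace_of_eigenspaces:
  fixes D :: "'a::euclidean_space set"
  assumes n: "norm (outer_normal D \<xi>) = 1"
    and lin: "linear (hessian \<rho> \<xi>)" and sym: "\<And>u v. hessian \<rho> \<xi> u \<bullet> v = hessian \<rho> \<xi> v \<bullet> u"
    and "finite I" "\<And>\<mu>. \<mu> \<in> I \<Longrightarrow> m \<le> \<mu>"
  shows "\<exists>P. subspace P \<and> P \<subseteq> tangent_space D \<xi> \<and>
    dim P = (\<Sum>\<mu>\<in>I. dim (tangential_eigenspace D \<xi> \<rho> \<mu>)) \<and>
    (\<forall>x\<in>P. \<forall>y. (\<forall>\<mu>\<in>I. \<forall>u\<in>tangential_eigenspace D \<xi> \<rho> \<mu>. u \<bullet> y = 0) \<longrightarrow> x \<bullet> y = 0) \<and>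
    (\<forall>u\<in>P. m * (norm u)\<^sup>2 \<le> hessian \<rho> \<xi> u \<bullet> u)"
  using assms(4,5)
proof (induction I)
  case empty
  then show ?case
    by (intro exI[of _ "{0}"])
      (auto simp: tangent_space_def linear_0[OF lin] subspace_0)
next
  case (insert \<nu> I)
  let ?H = "hessian \<rho> \<xi>" and ?E = "tangential_eigenspace D \<xi> \<rho>" and ?T = "tangent_space D \<xi>"
  obtain P where P: "subspace P" "P \<subseteq> ?T" "dim P = (\<Sum>\<mu>\<in>I. dim (?E \<mu>))"
    "\<And>x y. x \<in> P \<Longrightarrow> (\<And>\<mu> u. \<mu> \<in> I \<Longrightarrow> u \<in> ?E \<mu> \<Longrightarrow> u \<bullet> y = 0) \<Longrightarrow> x \<bullet> y = 0"
    "\<And>u. u \<in> P \<Longrightarrow> m * (norm u)\<^sup>2 \<le> ?H u \<bullet> u"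
  proof (rule exE[OF insert.IH], goal_cases)
    case (1 \<mu>)
    then show ?case by (intro insert.prems) blast
  next
    case (2 P)
    then show ?case by (intro that[of P]) blast+
  qed
  have ET: "?E \<mu> \<subseteq> ?T" for \<mu> by (auto simp: tangential_eigenspace_def)
  have eig: "?H u \<bullet> x = \<mu> * (u \<bullet> x)" if "u \<in> ?E \<mu>" "x \<in> ?T" for \<mu> u x
  proof -
    have "?H u \<bullet> x = tangential_part D \<xi> (?H u) \<bullet> x"
      using that(2) by (simp add: tangential_part_def normal_part_def tangent_space_def
          inner_diff_left inner_diff_right inner_commute)
    then show ?thesis using that(1) by (simp add: tangential_eigenspace_def)
  qed
  have subE: "subspace (?E \<nu>)"
    by (rule subspaceI)
      (simp_all add: tangential_eigenspace_def tangent_space_def inner_add_left scaleR_add_right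
        linear_0[OF lin] linear_add[OF lin] linear_cmul[OF lin]
        linear_0[OF linear_tangential_part] linear_add[OF linear_tangential_part]
        linear_cmul[OF linear_tangential_part])
  have PE: "x \<bullet> y = 0" if "x \<in> P" "y \<in> ?E \<nu>" for x y
  proof (rule P(4)[OF that(1)])
    fix \<mu> u assume u: "\<mu> \<in> I" "u \<in> ?E \<mu>"
    have "\<mu> * (u \<bullet> y) = \<nu> * (u \<bullet> y)"
      using eig[OF u(2)] eig[OF that(2)] sym[of u y] ET u(2) that(2) by (metis inner_commute subsetD)
    then show "u \<bullet> y = 0" using u(1) insert.hyps by auto
  qed
  define Q where "Q = {x + y |x y. x \<in> P \<and> y \<in> ?E \<nu>}"
  have "P \<inter> ?E \<nu> = {0}"
  proof -
    have "x = 0" if "x \<in> P" "x \<in> ?E \<nu>" for x using PE[OF that] by simp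
    then show ?thesis using subspace_0[OF P(1)] subspace_0[OF subE] by blast
  qed
  then have "dim Q = (\<Sum>\<mu>\<in>insert \<nu> I. dim (?E \<mu>))"
    using dim_sums_Int[OF P(1) subE] P(3) insert.hyps by (simp add: Q_def)
  moreover have "subspace Q" unfolding Q_def by (intro subspace_sums P(1) subE)
  moreover have "Q \<subseteq> ?T"
    using P(2) ET[of \<nu>] unfolding Q_def tangent_space_def by (fastforce simp: inner_add_left)
  moreover have "z \<bullet> y = 0"
    if z: "z \<in> Q" "\<forall>\<mu>\<in>insert \<nu> I. \<forall>u\<in>?E \<mu>. u \<bullet> y = 0" for z y
  proof -
    obtain x y' where xy: "z = x + y'" "x \<in> P" "y' \<in> ?E \<nu>" using z(1) unfolding Q_def by blast
    have "x \<bullet> y = 0" by (rule P(4)[OF xy(2)]) (use that(2) in blast)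
    moreover have "y' \<bullet> y = 0" using that(2) xy(3) by blast
    ultimately show ?thesis by (simp add: xy(1) inner_add_left)
  qed
  moreover have "m * (norm z)\<^sup>2 \<le> ?H z \<bullet> z" if z: "z \<in> Q" for z
  proof -
    obtain x y where xy: "z = x + y" "x \<in> P" "y \<in> ?E \<nu>" using z unfolding Q_def by blast
    have 0: "x \<bullet> y = 0" by (rule PE[OF xy(2,3)])
    have "x \<in> ?T" "y \<in> ?T" using xy P(2) ET by blast+
    then have Hy: "?H y \<bullet> x = 0" "?H y \<bullet> y = \<nu> * (y \<bullet> y)"
      using eig[OF xy(3)] 0 by (simp_all add: inner_commute)
    have "m * (norm z)\<^sup>2 = m * (norm x)\<^sup>2 + m * (y \<bullet> y)"
      unfolding power2_norm_eq_inner xy(1) using 0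
      by (simp add: inner_add_left inner_add_right inner_commute algebra_simps)
    also have "\<dots> \<le> ?H x \<bullet> x + \<nu> * (y \<bullet> y)"
      using P(5)[OF xy(2)] insert.prems by (intro add_mono mult_right_mono) auto
    also have "\<dots> = ?H z \<bullet> z"
      using Hy sym[of x y] by (simp add: xy(1) linear_add[OF lin] inner_add_left inner_add_right)
    finally show ?thesis .
  qed
  ultimately show ?case by (intro exI[of _ Q] conjI ballI allI impI) blast+
qed

text \<open>An infinite index set makes the sum defining \<open>num_pos_eigenvalues\<close> zero, and then \<open>{0}\<close> will do.\<close>

lemma positive_definite_tangent_subspace:
  fixes D :: "'a::euclidean_space set"
  assumes n: "norm (outer_normal D \<xi>) = 1"
    and lin: "linear (hessian \<rho> \<xi>)" and sym: "\<And>u v. hessian \<rho> \<xi> u \<bullet> v = hessian \<rho> \<xi> v \<bullet> u"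
  obtains P m where "subspace P" "P \<subseteq> tangent_space D \<xi>" "dim P = num_pos_eigenvalues D \<xi> \<rho>"
    "m > 0" "\<And>u. u \<in> P \<Longrightarrow> m * (norm u)\<^sup>2 \<le> hessian \<rho> \<xi> u \<bullet> u"
proof -
  define I where "I = {\<mu>. \<mu> > 0 \<and> tangential_eigenspace D \<xi> \<rho> \<mu> \<noteq> {0}}"
  show thesis
  proof (cases "finite I")
    case True
    define m where "m = Min (insert 1 I)"
    have "m > 0" "\<And>\<mu>. \<mu> \<in> I \<Longrightarrow> m \<le> \<mu>" using True by (auto simp: m_def I_def)
    then obtain P where "subspace P \<and> P \<subseteq> tangent_space D \<xi> \<and> dim P = num_pos_eigenvalues D \<xi> \<rho> \<and>
        (\<forall>u\<in>P. m * (norm u)\<^sup>2 \<le> hessian \<rho> \<xi> u \<bullet> u)"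
      using positive_definite_subspace_of_eigenspaces[OF n lin sym True, of m]
      unfolding num_pos_eigenvalues_def I_def[symmetric] by blast
    then show thesis using that[of P m] \<open>m > 0\<close> by blast
  next
    case False
    then have "num_pos_eigenvalues D \<xi> \<rho> = 0" unfolding num_pos_eigenvalues_def I_def[symmetric] by simp
    then show thesis
      by (intro that[of "{0}" 1]) (auto simp: tangent_space_def subspace_0)
  qed
qed

text \<open>A \<open>k\<close>-dimensional \<open>V\<close> may meet \<open>P\<close> only in 0, but it must meet the space spanned by \<open>P\<close> and \<open>n\<close>,
which is one dimension larger. A unit vector in the intersection is either visibly transversal, or
so close to \<open>P\<close> that it inherits half of the convexity there.\<close>

lemma subspace_contains_convex_direction:
  fixes H :: "'a::euclidean_space \<Rightarrow> 'a"
  assumes lin: "bounded_linear H" and n: "norm n = 1"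
    and P: "subspace P" "\<And>u. u \<in> P \<Longrightarrow> u \<bullet> n = 0" "DIM('a) - k \<le> dim P"
    and m: "m > 0" "\<And>u. u \<in> P \<Longrightarrow> m * (norm u)\<^sup>2 \<le> H u \<bullet> u"
  shows "\<exists>\<eta>>0. \<forall>V. subspace V \<and> dim V = k \<longrightarrow>
    (\<exists>w\<in>V. norm w = 1 \<and> (\<bar>w \<bullet> n\<bar> \<le> \<eta> \<longrightarrow> H w \<bullet> w \<ge> m / 2))"
proof -
  obtain K where K: "K > 0" "\<And>w. norm (H w) \<le> norm w * K"
    using bounded_linear.pos_bounded[OF lin] by blast
  interpret H: bounded_linear H by (rule lin)
  \<comment> \<open>For \<open>w = u + a n\<close> the cross terms and the normal term cost at most \<open>\<bar>a\<bar> * (m + 3 * K)\<close>.\<close>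
  define \<eta> where "\<eta> = min 1 (m / (2 * (m + 3 * K)))"
  have nn: "n \<bullet> n = 1" using n by (simp add: norm_eq_1)
  have \<eta>: "\<eta> > 0" "\<eta> \<le> 1" "\<eta> * (m + 3 * K) \<le> m / 2"
    using m(1) K(1) by (auto simp: \<eta>_def min_def field_simps)
  define S where "S = {x + y |x y. x \<in> P \<and> y \<in> span {n}}"
  have S: "subspace S" unfolding S_def by (intro subspace_sums subspace_span P)
  have "P \<inter> span {n} = {0}"
  proof -
    have "u = 0" if u: "u \<in> P" "u \<in> span {n}" for u
      using P(2)[OF u(1)] u(2) nn by (auto simp: span_singleton)
    then show ?thesis using P(1) span_zero subspace_0 by blast
  qed
  moreover have "n \<noteq> 0" using n by auto
  ultimately have dS: "dim S = dim P + 1"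
    using dim_sums_Int[OF P(1) subspace_span[of "{n}"]] by (simp add: S_def dim_singleton)
  have "\<exists>w\<in>V. norm w = 1 \<and> (\<bar>w \<bullet> n\<bar> \<le> \<eta> \<longrightarrow> H w \<bullet> w \<ge> m / 2)" if V: "subspace V" "dim V = k" for V
  proof -
    have "dim {x + y |x y. x \<in> V \<and> y \<in> S} \<le> DIM('a)" by (rule dim_subset_UNIV)
    then have "dim (V \<inter> S) \<noteq> 0"
      using dim_sums_Int[OF V(1) S] dS V(2) P(3) by linarith
    then obtain w0 where w0: "w0 \<in> V" "w0 \<in> S" "w0 \<noteq> 0" by (auto simp: dim_eq_0)
    define w where "w = w0 /\<^sub>R norm w0"
    have w: "w \<in> V" "w \<in> S" "norm w = 1"
      using w0 by (auto simp: w_def subspace_scale[OF V(1)] subspace_scale[OF S])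
    have "H w \<bullet> w \<ge> m / 2" if wn: "\<bar>w \<bullet> n\<bar> \<le> \<eta>"
    proof -
      obtain u a where u: "u \<in> P" "w = u + a *\<^sub>R n"
        using w(2) by (auto simp: S_def span_singleton)
      have un: "u \<bullet> n = 0" by (rule P(2)[OF u(1)])
      have a: "w \<bullet> n = a" by (simp add: u(2) inner_add_left un nn)
      have "(norm w)\<^sup>2 = (norm u)\<^sup>2 + a\<^sup>2"
        unfolding power2_norm_eq_inner u(2) using un nn
        by (simp add: inner_add_left inner_add_right inner_commute power2_eq_square)
      then have nu: "(norm u)\<^sup>2 = 1 - a\<^sup>2" using w(3) by simp
      have nu1: "norm u \<le> 1" by (rule power2_le_imp_le) (simp_all add: nu)
      have a1: "\<bar>a\<bar> \<le> \<eta>" using wn a by simp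
      have "\<bar>a\<bar> * \<bar>a\<bar> \<le> \<bar>a\<bar> * 1" using a1 \<eta>(2) by (intro mult_left_mono) auto
      then have aa: "a\<^sup>2 \<le> \<bar>a\<bar>" by (simp add: power2_eq_square)
      have b1: "\<bar>H u \<bullet> n\<bar> \<le> K"
      proof -
        have "\<bar>H u \<bullet> n\<bar> \<le> norm (H u)" using Cauchy_Schwarz_ineq2[of "H u" n] n by simp
        also have "\<dots> \<le> norm u * K" by (rule K(2))
        also have "\<dots> \<le> 1 * K" using nu1 K(1) by (intro mult_right_mono) auto
        finally show ?thesis by simp
      qed
      have b2: "\<bar>H n \<bullet> u\<bar> \<le> K"
      proof -
        have "\<bar>H n \<bullet> u\<bar> \<le> norm (H n) * norm u" by (rule Cauchy_Schwarz_ineq2)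
        also have "\<dots> \<le> K * 1" by (intro mult_mono) (use K(2)[of n] n nu1 K(1) in auto)
        finally show ?thesis by simp
      qed
      have b3: "\<bar>H n \<bullet> n\<bar> \<le> K"
        using order_trans[OF Cauchy_Schwarz_ineq2[of "H n" n]] K(2)[of n] n by simp
      have abs1: "a * z \<ge> - (\<bar>a\<bar> * K)" if "\<bar>z\<bar> \<le> K" for z
      proof -
        have "\<bar>a * z\<bar> \<le> \<bar>a\<bar> * K" using that by (simp add: abs_mult mult_left_mono)
        then show ?thesis by linarith
      qed
      have abs2: "a\<^sup>2 * (H n \<bullet> n) \<ge> - (\<bar>a\<bar> * K)"
      proof -
        have "\<bar>a\<^sup>2 * (H n \<bullet> n)\<bar> \<le> \<bar>a\<bar> * K"
          unfolding abs_mult using aa b3 by (intro mult_mono) auto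
        then show ?thesis by linarith
      qed
      have "H w \<bullet> w = H u \<bullet> u + a * (H u \<bullet> n) + a * (H n \<bullet> u) + a\<^sup>2 * (H n \<bullet> n)"
        unfolding u(2) H.add H.scale
        by (simp add: inner_add_left inner_add_right power2_eq_square algebra_simps)
      also have "\<dots> \<ge> m * (1 - a\<^sup>2) - 3 * (\<bar>a\<bar> * K)"
        using m(2)[OF u(1)] nu abs1[OF b1] abs1[OF b2] abs2 by simp
      finally have "H w \<bullet> w \<ge> m - (m * a\<^sup>2 + 3 * (\<bar>a\<bar> * K))" by (simp add: algebra_simps)
      moreover have "m * a\<^sup>2 + 3 * (\<bar>a\<bar> * K) \<le> m * \<bar>a\<bar> + 3 * (\<bar>a\<bar> * K)"
        using aa m(1) by simp
      moreover have "\<dots> = \<bar>a\<bar> * (m + 3 * K)" by (simp add: algebra_simps)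
      moreover have "\<dots> \<le> \<eta> * (m + 3 * K)" using a1 m(1) K(1) by (intro mult_right_mono) auto
      ultimately show ?thesis using \<eta>(3) by linarith
    qed
    then show ?thesis using w by blast
  qed
  then show ?thesis using \<eta>(1) by blast
qed

section \<open>The upper bound for the metric\<close>

text \<open>With \<open>b = u \<bullet> n\<close>, the inequality \<open>2 * b \<le> \<delta> + b\<^sup>2 / \<delta>\<close> turns the ball condition into
\<open>R * \<delta> \<le> (norm u)\<^sup>2 + (R - \<delta>) * b\<^sup>2 / \<delta>\<close>. This weighting is the one that is sharp when \<open>u\<close> runs along
the normal to the boundary point, where \<open>b = \<delta>\<close>, and it is why the normal term of the
conclusion has the exact coefficient \<open>1 / \<delta>\<^sup>2\<close>. As \<open>s\<close> is orthogonal to \<open>v\<close> and \<open>n\<close>, the slope of \<open>u\<close>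
against \<open>n\<close> is at most that of \<open>v\<close>.\<close>

lemma interior_ball_slice_bound:
  fixes v s n u :: "'a::real_inner"
  assumes R: "0 < \<delta>" "\<delta> < R" and n: "norm n = 1"
    and u: "u = a *\<^sub>R v + s" "s \<bullet> v = 0" "s \<bullet> n = 0"
    and ball: "2 * R * \<delta> - \<delta>\<^sup>2 \<le> (norm u)\<^sup>2 + 2 * (R - \<delta>) * (u \<bullet> n)"
  shows "(norm v)\<^sup>2 \<le> (norm u)\<^sup>2 * ((v \<bullet> n)\<^sup>2 / \<delta>\<^sup>2 + ((norm v)\<^sup>2 - (v \<bullet> n)\<^sup>2) / (R * \<delta>))"
proof -
  define b where "b = u \<bullet> n"
  have b: "b = a * (v \<bullet> n)" by (simp add: b_def u inner_add_left)
  have "(norm u)\<^sup>2 = a\<^sup>2 * (norm v)\<^sup>2 + (norm s)\<^sup>2"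
    unfolding power2_norm_eq_inner u(1)
    using u(2) by (simp add: inner_add_left inner_add_right inner_commute power2_eq_square)
  then have "a\<^sup>2 * (norm v)\<^sup>2 \<le> (norm u)\<^sup>2" by simp
  from mult_right_mono[OF this, of "(v \<bullet> n)\<^sup>2"]
  have bv: "b\<^sup>2 * (norm v)\<^sup>2 \<le> (norm u)\<^sup>2 * (v \<bullet> n)\<^sup>2"
    by (simp add: b power_mult_distrib mult_ac)
  have "0 \<le> (\<delta> - b)\<^sup>2" by simp
  then have "2 * b * \<delta> \<le> \<delta>\<^sup>2 + b\<^sup>2" by (simp add: power2_diff mult_ac)
  then have "2 * b \<le> \<delta> + b\<^sup>2 / \<delta>" using R by (simp add: field_simps power2_eq_square)
  from mult_left_mono[OF this, of "R - \<delta>"] R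
  have "2 * (R - \<delta>) * b \<le> (R - \<delta>) * (\<delta> + b\<^sup>2 / \<delta>)" by (simp add: mult_ac)
  then have "R * \<delta> \<le> (norm u)\<^sup>2 + (R - \<delta>) * (b\<^sup>2 / \<delta>)"
    using ball unfolding b_def[symmetric] by (simp add: algebra_simps power2_eq_square)
  from mult_right_mono[OF this, of "(norm v)\<^sup>2"]
  have "R * \<delta> * (norm v)\<^sup>2 \<le> (norm u)\<^sup>2 * (norm v)\<^sup>2 + (R - \<delta>) / \<delta> * (b\<^sup>2 * (norm v)\<^sup>2)"
    by (simp add: algebra_simps)
  also have "\<dots> \<le> (norm u)\<^sup>2 * (norm v)\<^sup>2 + (R - \<delta>) / \<delta> * ((norm u)\<^sup>2 * (v \<bullet> n)\<^sup>2)"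
    using bv R by (intro add_left_mono mult_left_mono) auto
  also have "\<dots> = R * \<delta> * ((norm u)\<^sup>2 * ((v \<bullet> n)\<^sup>2 / \<delta>\<^sup>2 + ((norm v)\<^sup>2 - (v \<bullet> n)\<^sup>2) / (R * \<delta>)))"
    using R by (simp add: field_simps power2_eq_square)
  finally show ?thesis using R by (simp add: mult_le_cancel_left)
qed

lemma k_bdist_pos:
  fixes v :: "'a::euclidean_space"
  assumes D: "open D" "x \<in> D" "frontier D \<noteq> {}" and k: "1 \<le> k" "k \<le> DIM('a)" and v: "v \<noteq> 0"
  shows "0 < k_bdist k D x v"
proof -
  define S where "S = {y. \<forall>z\<in>{v}. y \<bullet> z = 0}"
  have "k - 1 \<le> dim S"
    using dim_orthogonal_complement_ge[of "{v}"] k by (simp add: S_def)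
  moreover have "subspace S" by (simp add: S_def subspace_def inner_add_left)
  moreover have "s \<bullet> v = 0" if "s \<in> S" for s using that by (simp add: S_def)
  ultimately obtain V where "subspace V" "dim V = k" "v \<in> V"
    using subspace_through_vector[OF v _ _ k(1), of S] by metis
  then have "ereal (bdist D x) \<le> k_bdist k D x v" by (rule k_bdist_ge) (rule bdist_le)
  then show ?thesis using bdist_pos[OF D] by (metis ereal_less(2) less_le_trans)
qed

text \<open>The supremum defining \<open>k_bdist\<close> is tested on one subspace: \<open>v\<close> together with \<open>k - 1\<close> directions
orthogonal to both \<open>v\<close> and the normal. These exist because \<open>k < DIM('a)\<close>, and no vector of this
subspace is steeper than \<open>v\<close>, so the interior ball keeps the whole slice away from the
boundary.\<close>

lemma k_quasi_hyperbolic_upper_bound: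
  fixes v :: "'a::euclidean_space"
  assumes D: "open D" "convex D" and x: "x \<in> D" and p: "C2_boundary_point D p"
    and d: "dist x p = bdist D x" and R: "bdist D x < R"
    and ball: "ball (p - R *\<^sub>R outer_normal D p) R \<subseteq> D"
    and k: "1 \<le> k" "k < DIM('a)"
  shows "k_quasi_hyperbolic k D x v \<le> sqrt ((norm (normal_part D p v))\<^sup>2 / (4 * (bdist D x)\<^sup>2)
      + (norm (tangential_part D p v))\<^sup>2 / (4 * R * bdist D x))"
proof (cases "v = 0")
  case True
  then show ?thesis using R d zero_le_dist[of x p]
    by (simp add: k_quasi_hyperbolic_def)
next
  case False
  let ?n = "outer_normal D p" and ?\<delta> = "bdist D x"
  have "p \<in> frontier D" using p by (simp add: C2_boundary_point_def)
  then have \<delta>: "?\<delta> > 0" by (intro bdist_pos[OF D(1) x]) auto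
  have n: "norm ?n = 1" by (rule norm_outer_normal[OF D p])
  define Q where "Q = (v \<bullet> ?n)\<^sup>2 / ?\<delta>\<^sup>2 + ((norm v)\<^sup>2 - (v \<bullet> ?n)\<^sup>2) / (R * ?\<delta>)"
  have le: "(v \<bullet> ?n)\<^sup>2 \<le> (norm v)\<^sup>2" using norm_normal_part(2)[OF n, of v] by (metis diff_ge_0_iff_ge zero_le_power2)
  have "Q > 0"
  proof (cases "v \<bullet> ?n = 0")
    case True then show ?thesis using False R \<delta> by (simp add: Q_def)
  next
    case vn: False
    then show ?thesis unfolding Q_def using R \<delta> le by (intro add_pos_nonneg) auto
  qed
  define S where "S = {y. \<forall>z\<in>{v, ?n}. y \<bullet> z = 0}"
  have "card {v, ?n} \<le> 2" by (simp add: card_insert_if)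
  then have "k - 1 \<le> dim S"
    using dim_orthogonal_complement_ge[of "{v, ?n}"] k unfolding S_def by simp
  moreover have "subspace S" by (simp add: S_def subspace_def inner_add_left)
  moreover have "s \<bullet> v = 0" if "s \<in> S" for s using that by (simp add: S_def)
  ultimately obtain V where V: "subspace V" "dim V = k" "v \<in> V"
    "\<And>u. u \<in> V \<Longrightarrow> \<exists>a s. s \<in> S \<and> u = a *\<^sub>R v + s"
    using subspace_through_vector[OF False _ _ k(1), of S] by metis
  \<comment> \<open>\<open>Q\<close> is the square of the claimed bound for \<open>norm v / dist x y\<close> at boundary points \<open>y\<close> of the slice.\<close>
  define r where "r = norm v / sqrt Q"
  have r: "r > 0" using False \<open>Q > 0\<close> by (simp add: r_def)
  have "ereal r \<le> k_bdist k D x v"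
  proof (rule k_bdist_ge[OF V(1-3)])
    fix y assume y: "y \<in> (+) x ` V" "y \<in> frontier D"
    then have "y - x \<in> V" by auto
    then obtain a s where as: "s \<in> S" "y - x = a *\<^sub>R v + s" using V(4) by blast
    have "y \<notin> ball (p - R *\<^sub>R ?n) R" using ball y(2) D by (auto simp: frontier_def interior_open)
    from interior_ball_inner_bound[OF this nearest_boundary_point_along_normal[OF D x p d] n] R \<delta>
    have "2 * R * ?\<delta> - ?\<delta>\<^sup>2 \<le> (norm (y - x))\<^sup>2 + 2 * (R - ?\<delta>) * ((y - x) \<bullet> ?n)" by simp
    from interior_ball_slice_bound[OF \<delta> R n as(2) _ _ this] as(1)
    have "(norm v)\<^sup>2 \<le> (norm (y - x))\<^sup>2 * Q" by (simp add: S_def Q_def)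
    then have "(norm v)\<^sup>2 \<le> (norm (y - x) * sqrt Q)\<^sup>2" using \<open>Q > 0\<close> by (simp add: power_mult_distrib)
    then have "norm v \<le> norm (y - x) * sqrt Q" by (rule power2_le_imp_le) (use \<open>Q > 0\<close> in auto)
    then show "r \<le> dist x y" using \<open>Q > 0\<close> by (simp add: r_def dist_norm norm_minus_commute field_simps)
  qed
  from k_quasi_hyperbolic_le[OF this r]
  have "k_quasi_hyperbolic k D x v \<le> sqrt Q / 2" using False \<open>Q > 0\<close> by (simp add: r_def)
  also have "\<dots> = sqrt (Q / 4)" by (simp add: real_sqrt_divide)
  also have "Q / 4 = (norm (normal_part D p v))\<^sup>2 / (4 * ?\<delta>\<^sup>2) + (norm (tangential_part D p v))\<^sup>2 / (4 * R * ?\<delta>)"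
    using \<delta> R by (simp add: Q_def norm_normal_part[OF n] add_divide_distrib mult_ac)
  finally show ?thesis .
qed

section \<open>Boundary distance in slices through positively curved points\<close>

text \<open>Every \<open>k\<close>-dimensional slice through \<open>x\<close> contains a unit direction \<open>w\<close> that is either transversal to the
boundary or one of strict convexity of \<open>\<rho>\<close>. A transversal line leaves \<open>D\<close> within a multiple of
\<open>bdist D x\<close>. In the other case \<open>\<rho> x\<close> is at least \<open>- G * bdist D x\<close>, and moving along \<open>w\<close> in the sense in
which \<open>\<rho>\<close> does not decrease at first order makes \<open>\<rho>\<close> grow at least like \<open>t\<^sup>2 * m / 8\<close>, so \<open>\<rho>\<close> is positive at
time \<open>sqrt (8 * G * bdist D x / m)\<close>.\<close>

lemma einfdist_le_sqrt_bdist: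
  fixes D :: "'a::euclidean_space set"
  assumes D: "open D" "convex D" and \<xi>: "\<xi> \<in> frontier D"
    and \<rho>: "C2_defining_function D \<xi> W \<rho>" "DIM('a) - k \<le> num_pos_eigenvalues D \<xi> \<rho>"
  shows "\<exists>C>0. \<exists>r>0. \<forall>x \<in> D \<inter> ball \<xi> r. \<forall>V. subspace V \<and> dim V = k \<longrightarrow>
    einfdist x ((+) x ` V \<inter> frontier D) \<le> ereal (C * sqrt (bdist D x))"
proof -
  let ?H = "hessian \<rho> \<xi>" and ?n = "outer_normal D"
  note F = C2_defining_functionD[OF \<rho>(1) \<xi>]
  have C2\<xi>: "C2_boundary_point D \<xi>" using \<rho> \<xi> by (auto simp: C2_boundary_point_def)
  have n\<xi>: "norm (?n \<xi>) = 1" by (rule norm_outer_normal[OF D C2\<xi>])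
  have dg: "grad \<rho> differentiable (at y)" if "y \<in> W" for y using F(3) that by (auto simp: C2_on_def)
  have bl: "bounded_linear (hessian \<rho> y)" if "y \<in> W" for y
    by (rule has_derivative_bounded_linear[OF has_derivative_hessian[OF dg[OF that]]])
  have sym: "?H u \<bullet> v = ?H v \<bullet> u" for u v
  proof -
    obtain e where e: "e > 0" "ball \<xi> e \<subseteq> W" using F(1,2) openE by blast
    show ?thesis
      by (rule hessian_symmetric[OF e(1) _ dg[OF F(2)]]) (use F(3) e in \<open>auto simp: C2_on_def\<close>)
  qed
  obtain P m where P: "subspace P" "P \<subseteq> tangent_space D \<xi>" "dim P = num_pos_eigenvalues D \<xi> \<rho>"
    and m: "m > 0" "\<And>u. u \<in> P \<Longrightarrow> m * (norm u)\<^sup>2 \<le> ?H u \<bullet> u"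
    using positive_definite_tangent_subspace[OF n\<xi> bounded_linear.linear[OF bl[OF F(2)]] sym] by metis
  have "u \<bullet> ?n \<xi> = 0" if "u \<in> P" for u using P(2) that by (auto simp: tangent_space_def)
  then obtain \<eta> where \<eta>: "\<eta> > 0" "\<And>V. subspace V \<Longrightarrow> dim V = k \<Longrightarrow>
      \<exists>w\<in>V. norm w = 1 \<and> (\<bar>w \<bullet> ?n \<xi>\<bar> \<le> \<eta> \<longrightarrow> ?H w \<bullet> w \<ge> m / 2)"
    using subspace_contains_convex_direction[OF bl[OF F(2)] n\<xi> P(1) _ _ m, of k] P(3) \<rho>(2) by metis
  obtain K where K: "K > 0" "\<And>w. norm (?H w) \<le> norm w * K"
    using bounded_linear.pos_bounded[OF bl[OF F(2)]] by blast
  have "m / 4 > 0" using m by simp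
  then obtain r0 where r0: "r0 > 0" "ball \<xi> r0 \<subseteq> W"
    "\<And>y w. y \<in> ball \<xi> r0 \<Longrightarrow> norm (hessian \<rho> y w - ?H w) \<le> m / 4 * norm w"
    using hessian_operator_continuous[OF F(3,1,2), of "m / 4"] by blast
  define M where "M = K + m / 4"
  have M: "M > 0" using K m by (simp add: M_def)
  have HM: "\<bar>hessian \<rho> y w \<bullet> w\<bar> \<le> M * (norm w)\<^sup>2" if "y \<in> ball \<xi> r0" for y w
  proof -
    have "norm (hessian \<rho> y w) \<le> M * norm w"
      using r0(3)[OF that, of w] K(2)[of w] norm_triangle_sub[of "hessian \<rho> y w" "?H w"]
      by (simp add: M_def algebra_simps)
    then have "norm (hessian \<rho> y w) * norm w \<le> M * norm w * norm w" by (rule mult_right_mono) simp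
    then show ?thesis
      using Cauchy_Schwarz_ineq2[of "hessian \<rho> y w" w] by (simp add: power2_eq_square mult.assoc)
  qed
  have Hm: "hessian \<rho> y w \<bullet> w \<ge> m / 4" if "y \<in> ball \<xi> r0" "norm w = 1" "?H w \<bullet> w \<ge> m / 2" for y w
  proof -
    have "\<bar>(hessian \<rho> y w - ?H w) \<bullet> w\<bar> \<le> m / 4"
      using Cauchy_Schwarz_ineq2[of "hessian \<rho> y w - ?H w" w] r0(3)[OF that(1), of w] that(2) by simp
    then show ?thesis using that(3) unfolding inner_diff_left by linarith
  qed
  define g where "g = norm (grad \<rho> \<xi>)"
  have cg: "isCont (grad \<rho>) \<xi>" by (rule differentiable_imp_continuous_within[OF dg[OF F(2)]])
  then have "isCont (\<lambda>y. norm (grad \<rho> y)) \<xi>" by (rule continuous_norm)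
  then obtain r1 where r1: "r1 > 0" "\<And>y. dist y \<xi> < r1 \<Longrightarrow> \<bar>norm (grad \<rho> y) - g\<bar> < 1"
    unfolding continuous_at_eps_delta g_def dist_real_def by (meson zero_less_one)
  have "isCont (\<lambda>y. grad \<rho> y /\<^sub>R norm (grad \<rho> y)) \<xi>"
    using cg F(5) by (intro continuous_intros) auto
  then obtain r2 where r2: "r2 > 0"
    "\<And>y. dist y \<xi> < r2 \<Longrightarrow> dist (grad \<rho> y /\<^sub>R norm (grad \<rho> y)) (grad \<rho> \<xi> /\<^sub>R norm (grad \<rho> \<xi>)) < \<eta> / 2"
    using \<eta>(1) unfolding continuous_at_eps_delta by (meson half_gt_zero)
  define G where "G = g + 1 + M"
  have G: "G > 0" using M by (simp add: G_def g_def add_nonneg_pos)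
  define C0 where "C0 = sqrt (8 * G / m)"
  have C0: "C0 > 0" "C0\<^sup>2 = 8 * G / m" using G m by (auto simp: C0_def)
  \<comment> \<open>The factors 2 put the nearest point \<open>p\<close> into the good balls, and the last term ensures that the
  exit time \<open>C0 * sqrt \<delta>\<close> is below \<open>r0 / 2\<close>.\<close>
  define r where "r = min (min 1 (r0 / 2)) (min (min r1 r2 / 2) ((r0 / (2 * C0))\<^sup>2))"
  have r: "r > 0" "r \<le> 1" "2 * r \<le> r0" "2 * r \<le> r1" "2 * r \<le> r2" "r \<le> (r0 / (2 * C0))\<^sup>2"
    using r0 r1 r2 C0 by (auto simp: r_def)
  define C where "C = max C0 (2 / \<eta>)"
  have C: "C > 0" "C0 \<le> C" "2 / \<eta> \<le> C" using C0 by (auto simp: C_def)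
  have "einfdist x ((+) x ` V \<inter> frontier D) \<le> ereal (C * sqrt (bdist D x))"
    if x: "x \<in> D" "x \<in> ball \<xi> r" and V: "subspace V" "dim V = k" for x V
  proof -
    define \<delta> where "\<delta> = bdist D x"
    have \<delta>: "\<delta> > 0" "\<delta> < r"
      using bdist_pos[OF D(1) x(1)] \<xi> bdist_le[OF \<xi>, of x] x(2) by (auto simp: \<delta>_def dist_commute)
    have \<delta>1: "\<delta> < 1" using \<delta> r by simp
    have s\<delta>: "\<delta> \<le> sqrt \<delta>" using \<delta>1 \<delta>(1) by (intro real_le_rsqrt) (simp add: power2_eq_square mult_left_le)
    obtain p where p: "p \<in> frontier D" "dist x p = bdist D x"
      using nearest_boundary_point \<xi> by blast
    have pb: "p \<in> ball \<xi> (2 * r)" by (rule nearest_boundary_point_near[OF p \<xi> x(2)])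
    have pW: "p \<in> W" using pb r r0(2) by auto
    note \<rho>p = C2_defining_function_recenter[OF \<rho>(1) pW]
    have C2p: "C2_boundary_point D p" using \<rho>p p by (auto simp: C2_boundary_point_def)
    obtain w where w: "w \<in> V" "norm w = 1" "\<bar>w \<bullet> ?n \<xi>\<bar> \<le> \<eta> \<Longrightarrow> ?H w \<bullet> w \<ge> m / 2"
      using \<eta>(2)[OF V] by blast
    show ?thesis
    proof (cases "\<bar>w \<bullet> ?n \<xi>\<bar> \<le> \<eta>")
      case True
      have Hw: "hessian \<rho> y w \<bullet> w \<ge> m / 4" if "y \<in> ball \<xi> r0" for y
        by (rule Hm[OF that w(2) w(3)[OF True]])
      define h where "h = x - p"
      have nh: "norm h = \<delta>" using p by (simp add: h_def \<delta>_def dist_norm)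
      have seg1: "closed_segment p (p + h) \<subseteq> ball \<xi> r0"
        by (rule closed_segment_subset) (use pb x(2) r in \<open>auto simp: h_def\<close>)
      obtain z1 where z1: "z1 \<in> closed_segment p (p + h)"
        "\<rho> (p + h) = \<rho> p + h \<bullet> grad \<rho> p + (hessian \<rho> z1 h \<bullet> h) / 2"
        using second_order_Taylor[OF F(3) order_trans[OF seg1 r0(2)]] .
      have "norm (grad \<rho> p) < g + 1" using r1(2)[of p] pb r unfolding mem_ball dist_commute[of \<xi>] by linarith
      then have "\<bar>h \<bullet> grad \<rho> p\<bar> \<le> \<delta> * (g + 1)"
        using Cauchy_Schwarz_ineq2[of h "grad \<rho> p"] nh \<delta>(1)
        by (smt (verit, best) mult_left_mono)
      moreover have "\<bar>hessian \<rho> z1 h \<bullet> h\<bar> \<le> M * \<delta>\<^sup>2" using HM[of z1 h] z1(1) seg1 nh by auto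
      moreover have "M * \<delta>\<^sup>2 \<le> M * \<delta>"
        using M \<delta>(1) \<delta>1 by (intro mult_left_mono) (auto simp: power2_eq_square mult_left_le)
      moreover have "M * \<delta> > 0" using M \<delta> by simp
      moreover have "\<delta> * (g + 1) + M * \<delta> = G * \<delta>" by (simp add: G_def algebra_simps)
      ultimately have \<rho>x: "\<rho> x > - (G * \<delta>)"
        using z1(2) C2_defining_functionD(4)[OF \<rho>p p(1)] unfolding h_def by auto
      define t0 where "t0 = C0 * sqrt \<delta>"
      define t where "t = (if w \<bullet> grad \<rho> x \<ge> 0 then t0 else - t0)"
      have t0: "t0 > 0" "t0\<^sup>2 = 8 * G / m * \<delta>" using C0 \<delta> by (auto simp: t0_def power_mult_distrib)
      have t: "t * (w \<bullet> grad \<rho> x) \<ge> 0" "\<bar>t\<bar> = t0" "t\<^sup>2 = t0\<^sup>2"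
        using t0(1) by (auto simp: t_def mult_nonneg_nonneg mult_nonneg_nonpos)
      have "sqrt \<delta> < r0 / (2 * C0)"
        using r(6) \<delta>(2) r0(1) C0(1) by (intro real_less_lsqrt) auto
      then have "t0 < r0 / 2" using C0(1) by (simp add: t0_def field_simps)
      moreover have "dist \<xi> (x + t *\<^sub>R w) \<le> dist \<xi> x + \<bar>t\<bar>"
        using dist_triangle[of \<xi> "x + t *\<^sub>R w" x] w(2) by (simp add: dist_norm)
      ultimately have xt: "x + t *\<^sub>R w \<in> ball \<xi> r0" using x(2) r(3) t(2) by auto
      have seg2: "closed_segment x (x + t *\<^sub>R w) \<subseteq> ball \<xi> r0"
        by (rule closed_segment_subset) (use xt x(2) r(1,3) in auto)
      obtain z2 where z2: "z2 \<in> closed_segment x (x + t *\<^sub>R w)"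
        "\<rho> (x + t *\<^sub>R w) = \<rho> x + (t *\<^sub>R w) \<bullet> grad \<rho> x + (hessian \<rho> z2 (t *\<^sub>R w) \<bullet> (t *\<^sub>R w)) / 2"
        using second_order_Taylor[OF F(3) order_trans[OF seg2 r0(2)]] .
      have z2b: "z2 \<in> ball \<xi> r0" using z2(1) seg2 by blast
      interpret H: bounded_linear "hessian \<rho> z2" using bl z2b r0(2) by blast
      have "hessian \<rho> z2 (t *\<^sub>R w) \<bullet> (t *\<^sub>R w) = t\<^sup>2 * (hessian \<rho> z2 w \<bullet> w)"
        by (simp add: H.scale power2_eq_square)
      also have "\<dots> \<ge> t\<^sup>2 * (m / 4)" using Hw[OF z2b] by (intro mult_left_mono) auto
      moreover have "t\<^sup>2 * (m / 4) = 2 * (G * \<delta>)" using m by (simp add: t(3) t0(2))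
      ultimately have "\<rho> (x + t *\<^sub>R w) > 0" using z2(2) t(1) \<rho>x by simp
      then have "x + t *\<^sub>R w \<notin> D" using F(7)[of "x + t *\<^sub>R w"] xt r0(2) by auto
      from einfdist_le_exit[OF x(1) V(1) subspace_scale[OF V(1) w(1)] this]
      have "einfdist x ((+) x ` V \<inter> frontier D) \<le> ereal t0" using w(2) t(2) by simp
      also have "\<dots> \<le> ereal (C * sqrt \<delta>)" using C(2) \<delta> by (simp add: t0_def mult_right_mono)
      finally show ?thesis by (simp add: \<delta>_def)
    next
      case False
      have "dist (?n p) (?n \<xi>) < \<eta> / 2"
        unfolding outer_normal_eq[OF D \<rho>p p(1)] outer_normal_eq[OF D \<rho>(1) \<xi>]
        using r2(2)[of p] pb r unfolding mem_ball dist_commute[of \<xi>] by linarith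
      then have "\<bar>w \<bullet> (?n p - ?n \<xi>)\<bar> < \<eta> / 2"
        using Cauchy_Schwarz_ineq2[of w "?n p - ?n \<xi>"] w(2) by (simp add: dist_norm)
      then have wp: "\<bar>w \<bullet> ?n p\<bar> > \<eta> / 2" using False unfolding inner_diff_right by linarith
      then have "einfdist x ((+) x ` V \<inter> frontier D) \<le> ereal (bdist D x * norm w / \<bar>w \<bullet> ?n p\<bar>)"
        using \<eta>(1) by (intro einfdist_le_along_normal[OF D x(1) C2p p(2) V(1) w(1)]) auto
      also have "bdist D x * norm w / \<bar>w \<bullet> ?n p\<bar> \<le> \<delta> / (\<eta> / 2)"
        using wp \<eta>(1) \<delta>(1) w(2) unfolding \<delta>_def[symmetric] by (simp only: mult_1_right) (intro divide_left_mono mult_pos_pos; linarith)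
      also have "\<dots> = 2 / \<eta> * \<delta>" by simp
      also have "\<dots> \<le> C * sqrt \<delta>" using C s\<delta> \<delta>(1) by (intro mult_mono) auto
      finally show ?thesis by (simp add: \<delta>_def)
    qed
  qed
  then show ?thesis using C(1) r(1) by blast
qed

section \<open>The estimate of the metric\<close>

theorem proposition4p17:
  fixes D :: "(real ^ 'd) set" and \<xi> :: "real ^ 'd" and k :: nat
  assumes "CARD('d) \<ge> 2"
    and "1 \<le> k" and "k \<le> CARD('d)"
    and "open D" and "connected D" and "convex D"
    and "\<xi> \<in> frontier D"
    and "strongly_convex_boundary_point k D \<xi>"
  shows "\<exists>c C1 C2 :: real. \<exists>U. c > 0 \<and> C1 > 0 \<and> C2 > 0 \<and> open U \<and> \<xi> \<in> U \<and>
    (\<forall>x\<in>U. (\<exists>!p. p \<in> frontier D \<and> dist x p = bdist D x) \<and>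
      C2_boundary_point D (closest_point (frontier D) x)) \<and>
    (\<forall>x \<in> D \<inter> U. \<forall>v.
      let p = closest_point (frontier D) x;
          vN = normal_part D p v;
          vT = tangential_part D p v
      in max (norm vN / (2 * bdist D x)) (c * norm vT / sqrt (bdist D x))
            \<le> k_quasi_hyperbolic k D x v \<and>
         (k < CARD('d) \<longrightarrow>
            k_quasi_hyperbolic k D x v
              \<le> sqrt ((1 + C1 * bdist D x) * ((norm vN)\<^sup>2 / (4 * (bdist D x)\<^sup>2)) +
                      C2 * ((norm vT)\<^sup>2 / bdist D x))))"
proof -
  note D = \<open>open D\<close> \<open>convex D\<close> and \<xi> = \<open>\<xi> \<in> frontier D\<close>
  obtain W \<rho> where \<rho>: "C2_defining_function D \<xi> W \<rho>" "DIM(real ^ 'd) - k \<le> num_pos_eigenvalues D \<xi> \<rho>"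
    using assms(8) by (auto simp: strongly_convex_boundary_point_def)
  obtain R r1 where R: "R > 0" and r1: "r1 > 0" "ball \<xi> r1 \<subseteq> W"
    "\<And>p. p \<in> frontier D \<inter> ball \<xi> r1 \<Longrightarrow> ball (p - R *\<^sub>R outer_normal D p) R \<subseteq> D"
    using uniform_interior_ball[OF D \<rho>(1) \<xi>] by metis
  obtain C r2 where C: "C > 0" and r2: "r2 > 0"
    "\<And>x V. x \<in> D \<inter> ball \<xi> r2 \<Longrightarrow> subspace V \<Longrightarrow> dim V = k \<Longrightarrow>
      einfdist x ((+) x ` V \<inter> frontier D) \<le> ereal (C * sqrt (bdist D x))"
    using einfdist_le_sqrt_bdist[OF D \<xi> \<rho>] by metis
  \<comment> \<open>The nearest boundary point may be twice as far from \<open>\<xi>\<close> as \<open>x\<close>, hence \<open>r1 / 2\<close>.\<close>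
  define r where "r = min (min (r1 / 2) r2) R"
  have r: "r > 0" "2 * r \<le> r1" "r \<le> r2" "r \<le> R" using r1 r2 R by (auto simp: r_def)
  define U where "U = ball \<xi> r"
  have ne: "frontier D \<noteq> {}" using \<xi> by blast
  let ?\<pi> = "closest_point (frontier D)"
  note \<pi> = nearest_boundary_point[OF ne]
  have near: "?\<pi> x \<in> ball \<xi> r1" if "x \<in> U" for x
    using nearest_boundary_point_near[OF \<pi> \<xi>] that r(2) unfolding U_def by fastforce
  have C2: "C2_boundary_point D (?\<pi> x)" if "x \<in> U" for x
    using C2_defining_function_recenter[OF \<rho>(1)] near[OF that] r1(2) \<pi>(1)[of x]
    unfolding C2_boundary_point_def by blast
  have ball: "ball (?\<pi> x - R *\<^sub>R outer_normal D (?\<pi> x)) R \<subseteq> D" if "x \<in> U" for x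
    using r1(3) near[OF that] \<pi>(1) by blast
  have small: "bdist D x < R" if "x \<in> U" for x
    using bdist_le[OF \<xi>, of x] that r(4) by (simp add: U_def dist_commute)
  have unique: "\<exists>!p. p \<in> frontier D \<and> dist x p = bdist D x" if x: "x \<in> U" for x
  proof (rule ex1I[of _ "?\<pi> x"])
    show "?\<pi> x \<in> frontier D \<and> dist x (?\<pi> x) = bdist D x" using \<pi> by blast
    fix q assume q: "q \<in> frontier D \<and> dist x q = bdist D x"
    show "q = ?\<pi> x"
    proof (cases "x \<in> D")
      case True
      show ?thesis
        by (rule nearest_boundary_point_unique_inside[OF D True C2[OF x] \<pi>(2) small[OF x] ball[OF x]])
          (use q in auto)
    next
      case False
      show ?thesis
        by (rule nearest_boundary_point_unique_outside[OF D False \<pi>]) (use q in auto)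
    qed
  qed
  have bounds: "norm (normal_part D (?\<pi> x) v) / (2 * bdist D x) \<le> k_quasi_hyperbolic k D x v"
    "1 / (2 * C) * norm (tangential_part D (?\<pi> x) v) / sqrt (bdist D x) \<le> k_quasi_hyperbolic k D x v"
    "k < CARD('d) \<Longrightarrow> k_quasi_hyperbolic k D x v
        \<le> sqrt ((1 + 1 * bdist D x) * ((norm (normal_part D (?\<pi> x) v))\<^sup>2 / (4 * (bdist D x)\<^sup>2)) +
                1 / (4 * R) * ((norm (tangential_part D (?\<pi> x) v))\<^sup>2 / bdist D x))"
    if x: "x \<in> D" "x \<in> U" for x v
  proof -
    let ?n = "outer_normal D (?\<pi> x)" and ?\<delta> = "bdist D x"
    let ?N = "norm (normal_part D (?\<pi> x) v)" and ?T = "norm (tangential_part D (?\<pi> x) v)"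
    have \<delta>: "?\<delta> > 0" by (rule bdist_pos[OF D(1) x(1) ne])
    note n = norm_outer_normal[OF D C2[OF x(2)]]
    note parts = norm_normal_part[OF n, of v]
    have low: "norm v / (2 * s) \<le> k_quasi_hyperbolic k D x v"
      if "\<And>V. subspace V \<Longrightarrow> dim V = k \<Longrightarrow> v \<in> V \<Longrightarrow> einfdist x ((+) x ` V \<inter> frontier D) \<le> ereal s"
      and "v \<noteq> 0" for s
      by (rule k_quasi_hyperbolic_ge[OF k_bdist_le])
        (use that(1) k_bdist_pos[OF D(1) x(1) ne assms(2) _ that(2)] assms(3) in auto)
    have q0: "0 \<le> k_quasi_hyperbolic k D x v" if "v = 0" using that by (simp add: k_quasi_hyperbolic_def)
    show "?N / (2 * ?\<delta>) \<le> k_quasi_hyperbolic k D x v"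
    proof (cases "v \<bullet> ?n = 0")
      case True
      have "0 \<le> k_quasi_hyperbolic k D x v"
        by (cases "v = 0") (use q0 low[of "C * sqrt ?\<delta>"] r2(2) x r(3) C \<delta> in
            \<open>auto simp: U_def intro: order_trans[rotated]\<close>)
      then show ?thesis by (simp add: parts(1) True)
    next
      case False
      then have v: "v \<noteq> 0" by auto
      have "norm v / (2 * (?\<delta> * norm v / \<bar>v \<bullet> ?n\<bar>)) \<le> k_quasi_hyperbolic k D x v"
        using v by (intro low einfdist_le_along_normal[OF D x(1) C2[OF x(2)] \<pi>(2)] False)
      then show ?thesis using v by (simp add: parts(1))
    qed
    show "1 / (2 * C) * ?T / sqrt ?\<delta> \<le> k_quasi_hyperbolic k D x v"
    proof (cases "v = 0")
      case True
      then show ?thesis using parts(3) q0 by simp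
    next
      case False
      have "x \<in> D \<inter> ball \<xi> r2" using x r(3) by (auto simp: U_def)
      then have "norm v / (2 * (C * sqrt ?\<delta>)) \<le> k_quasi_hyperbolic k D x v"
        using False by (intro low r2(2))
      moreover have "1 / (2 * C) * ?T / sqrt ?\<delta> \<le> norm v / (2 * (C * sqrt ?\<delta>))"
        using parts(3) C \<delta> by (simp add: divide_right_mono mult.assoc)
      ultimately show ?thesis by simp
    qed
    assume k: "k < CARD('d)"
    have "k_quasi_hyperbolic k D x v \<le> sqrt (?N\<^sup>2 / (4 * ?\<delta>\<^sup>2) + ?T\<^sup>2 / (4 * R * ?\<delta>))"
      by (rule k_quasi_hyperbolic_upper_bound[OF D x(1) C2[OF x(2)] \<pi>(2) small[OF x(2)] ball[OF x(2)] assms(2)])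
        (use k in simp)
    also have "\<dots> \<le> sqrt ((1 + 1 * ?\<delta>) * (?N\<^sup>2 / (4 * ?\<delta>\<^sup>2)) + 1 / (4 * R) * (?T\<^sup>2 / ?\<delta>))"
      using \<delta> mult_right_mono[of 1 "1 + ?\<delta>" "?N\<^sup>2 / (4 * ?\<delta>\<^sup>2)"] by simp
    finally show "k_quasi_hyperbolic k D x v
        \<le> sqrt ((1 + 1 * ?\<delta>) * (?N\<^sup>2 / (4 * ?\<delta>\<^sup>2)) + 1 / (4 * R) * (?T\<^sup>2 / ?\<delta>))" .
  qed
  show ?thesis
    unfolding Let_def
    by (rule exI[of _ "1 / (2 * C)"], rule exI[of _ 1], rule exI[of _ "1 / (4 * R)"], rule exI[of _ U])
      (use C R r(1) C2 unique bounds in \<open>simp add: U_def\<close>)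
qed

end
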